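(* $\mathsf{SADC}\not\le_\mathrm{W}\mathsf{wRSgr}$.
   Context: Problems are multi-valued partial functions $\subseteq\omega^\omega\rightrightarrows\omega^\omega$ with standard codings. $\mathcal{F}\le_\mathrm{W}\mathcal{G}$ if there are Turing functionals $\Phi,\Psi$ with $\Phi(f)\in\mathrm{dom}(\mathcal{G})$ for all $f\in\mathrm{dom}(\mathcal{F})$ and $\Psi(\langle f,g\rangle)\in\mathcal{F}(f)$ for all $f\in\mathrm{dom}(\mathcal F)$, $g\in\mathcal{G}(\Phi(f))$. $\mathsf{SADC}$: input an infinite linear order $(L,<_L)$ with $L\subseteq\omega$ of order type $\omega+\omega^*$; output an infinite $C\subseteq L$ that is an ascending chain ($\{x\in C:x<_Ly\}$ finite for every $y\in C$) or a descending chain ($\{x\in C:y<_Lx\}$ finite for every $y\in C$). Graphs $G=(V,E)$ are simple with $V\subseteq\omega$ infinite, $E\subseteq[V]^2$; $N(v)=\{y:(v,y)\in E\}$. $\mathsf{wRSgr}$: input an infinite graph; output an infinite $H\subseteq V$ with, for all $v\in H$, $|H\cap N(v)|=\omega$ or $|H\cap N(v)|=0$. *)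

theory Defs
  imports
    "HOL-Library.Nat_Bijection"
    "HOL-Library.Indicator_Function"
    "HOL-Library.Ramsey"
begin

type_synonym baire = "nat \<Rightarrow> nat"

section \<open>Turing functionals\<close>

text \<open>
  Programs for Kleene's partial recursive functions relative to an oracle, and their
  big-step semantics. A program applied to too few arguments diverges.
\<close>

datatype prog =
    Zero
  | Succ
  | Proj nat
  | Query
  | Comp prog "prog list"
  | PrimRec prog prog
  | Mu prog

inductive evals :: "baire \<Rightarrow> prog \<Rightarrow> nat list \<Rightarrow> nat \<Rightarrow> bool" for f :: baire where
  zero: "evals f Zero xs 0"
| succ: "evals f Succ (x # xs) (Suc x)"
| proj: "i < length xs \<Longrightarrow> evals f (Proj i) xs (xs ! i)"
| query: "evals f Query (x # xs) (f x)"
| comp: "list_all2 (\<lambda>q y. evals f q xs y) qs ys \<Longrightarrow> evals f p ys z \<Longrightarrow> evals f (Comp p qs) xs z"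
| primrec_0: "evals f p xs y \<Longrightarrow> evals f (PrimRec p q) (0 # xs) y"
| primrec_Suc: "evals f (PrimRec p q) (n # xs) y \<Longrightarrow> evals f q (n # y # xs) z
    \<Longrightarrow> evals f (PrimRec p q) (Suc n # xs) z"
| mu: "evals f p (n # xs) 0 \<Longrightarrow> (\<forall>m<n. \<exists>y. evals f p (m # xs) (Suc y))
    \<Longrightarrow> evals f (Mu p) xs n"

inductive_cases evals_ZeroE: "evals f Zero xs z"
inductive_cases evals_SuccE: "evals f Succ xs z"
inductive_cases evals_ProjE: "evals f (Proj i) xs z"
inductive_cases evals_QueryE: "evals f Query xs z"
inductive_cases evals_CompE: "evals f (Comp p qs) xs z"
inductive_cases evals_PrimRec0E: "evals f (PrimRec p q) (0 # xs) z"
inductive_cases evals_PrimRecSucE: "evals f (PrimRec p q) (Suc n # xs) z"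
inductive_cases evals_MuE: "evals f (Mu p) xs z"

lemma evals_deterministic: "evals f p xs y \<Longrightarrow> evals f p xs z \<Longrightarrow> y = z"
proof (induction arbitrary: z rule: evals.induct)
  case (comp xs qs ys p w)
  from comp.prems obtain ys' where ys': "list_all2 (\<lambda>q y. evals f q xs y) qs ys'"
    and w: "evals f p ys' z"
    by (rule evals_CompE)
  have "ys = ys'"
    using comp.IH(1) ys'
    by (auto simp: list_all2_conv_all_nth intro!: nth_equalityI)
  with w comp.IH(2) show ?case by blast
next
  case (primrec_Suc p q n xs y w)
  from primrec_Suc.prems obtain y' where "evals f (PrimRec p q) (n # xs) y'"
    and "evals f q (n # y' # xs) z"
    by (rule evals_PrimRecSucE)
  with primrec_Suc.IH show ?case by blast
next
  case (mu p n xs)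
  from mu.prems have z: "evals f p (z # xs) 0" "\<forall>m<z. \<exists>y. evals f p (m # xs) (Suc y)"
    by (blast elim: evals_MuE)+
  show ?case
  proof (cases n z rule: linorder_cases)
    case less
    with z(2) mu.IH(1) show ?thesis by (metis nat.distinct(1))
  next
    case greater
    with mu.IH(2) z(1) show ?thesis by (metis nat.distinct(1))
  qed
qed (blast elim: evals_ZeroE evals_SuccE evals_ProjE evals_QueryE evals_PrimRec0E)+

text \<open>
  A Turing functional is partial on Baire space: it is defined at \<open>f\<close> iff the program,
  run with oracle \<open>f\<close>, halts on every input.
\<close>

definition turing_functional :: "(baire \<Rightarrow> baire option) \<Rightarrow> bool" where
  "turing_functional \<Phi> \<longleftrightarrow> (\<exists>p. \<forall>f g. \<Phi> f = Some g \<longleftrightarrow> (\<forall>n. evals f p [n] (g n)))"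

lemma ex_turing_functional:
  "\<exists>\<Phi>. turing_functional \<Phi> \<and> (\<forall>f g. \<Phi> f = Some g \<longleftrightarrow> (\<forall>n. evals f p [n] (g n)))"
proof -
  define \<Phi> where "\<Phi> f = (if \<exists>g. \<forall>n. evals f p [n] (g n)
      then Some (SOME g. \<forall>n. evals f p [n] (g n)) else None)" for f
  have "\<Phi> f = Some g \<longleftrightarrow> (\<forall>n. evals f p [n] (g n))" for f g
  proof
    assume "\<Phi> f = Some g"
    then have ex: "\<exists>g. \<forall>n. evals f p [n] (g n)" and g: "(SOME g. \<forall>n. evals f p [n] (g n)) = g"
      by (auto simp: \<Phi>_def split: if_splits)
    from someI_ex[OF ex] show "\<forall>n. evals f p [n] (g n)"
      unfolding g .
  next
    assume g: "\<forall>n. evals f p [n] (g n)"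
    then have "\<forall>n. evals f p [n] ((SOME g. \<forall>n. evals f p [n] (g n)) n)"
      by (rule someI[where P = "\<lambda>g. \<forall>n. evals f p [n] (g n)"])
    with g have "(SOME g. \<forall>n. evals f p [n] (g n)) = g"
      by (auto intro: evals_deterministic)
    with g show "\<Phi> f = Some g"
      by (auto simp: \<Phi>_def)
  qed
  then show ?thesis
    unfolding turing_functional_def by blast
qed

section \<open>Problems and Weihrauch reducibility\<close>

type_synonym problem = "baire \<Rightarrow> baire set"

definition pdom :: "problem \<Rightarrow> baire set" where
  "pdom P = {f. P f \<noteq> {}}"

definition join :: "baire \<Rightarrow> baire \<Rightarrow> baire" where
  "join f g n = (if even n then f (n div 2) else g (n div 2))"

definition weihrauch_le :: "problem \<Rightarrow> problem \<Rightarrow> bool" (infix \<open>\<le>\<^sub>W\<close> 50) where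
  "F \<le>\<^sub>W G \<longleftrightarrow> (\<exists>\<Phi> \<Psi>. turing_functional \<Phi> \<and> turing_functional \<Psi> \<and>
     (\<forall>f\<in>pdom F. \<exists>h. \<Phi> f = Some h \<and> h \<in> pdom G \<and>
        (\<forall>g\<in>G h. \<exists>k. \<Psi> (join f g) = Some k \<and> k \<in> F f)))"

lemma join_inject: "join f g = join f' g' \<longleftrightarrow> f = f' \<and> g = g'"
proof
  assume eq: "join f g = join f' g'"
  have "f n = f' n" "g n = g' n" for n
    using fun_cong[OF eq, of "2 * n"] fun_cong[OF eq, of "2 * n + 1"]
    by (simp_all add: join_def)
  then show "f = f' \<and> g = g'" by auto
qed simp

lemma indicator_inject: "(indicator A :: baire) = indicator B \<longleftrightarrow> A = B"
  by (auto simp: fun_eq_iff indicator_def split: if_splits)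

section \<open>Stable ascending/descending chains\<close>

fun less_omega_omega_star :: "nat + nat \<Rightarrow> nat + nat \<Rightarrow> bool" where
  "less_omega_omega_star (Inl m) (Inl n) \<longleftrightarrow> m < n"
| "less_omega_omega_star (Inl m) (Inr n) \<longleftrightarrow> True"
| "less_omega_omega_star (Inr m) (Inl n) \<longleftrightarrow> False"
| "less_omega_omega_star (Inr m) (Inr n) \<longleftrightarrow> n < m"

definition order_type_omega_omega_star :: "nat set \<Rightarrow> (nat \<times> nat) set \<Rightarrow> bool" where
  "order_type_omega_omega_star L R \<longleftrightarrow>
     (\<exists>h. bij_betw h L UNIV \<and> (\<forall>x\<in>L. \<forall>y\<in>L. (x, y) \<in> R \<longleftrightarrow> less_omega_omega_star (h x) (h y)))"

definition order_code :: "nat set \<Rightarrow> (nat \<times> nat) set \<Rightarrow> baire" where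
  "order_code L R = join (indicator L) (indicator (prod_encode ` R))"

definition SADC_input :: "nat set \<Rightarrow> (nat \<times> nat) set \<Rightarrow> bool" where
  "SADC_input L R \<longleftrightarrow> infinite L \<and> R \<subseteq> L \<times> L \<and> strict_linear_order_on L R \<and>
     order_type_omega_omega_star L R"

definition ascending_chain :: "(nat \<times> nat) set \<Rightarrow> nat set \<Rightarrow> bool" where
  "ascending_chain R C \<longleftrightarrow> (\<forall>y\<in>C. finite {x \<in> C. (x, y) \<in> R})"

definition descending_chain :: "(nat \<times> nat) set \<Rightarrow> nat set \<Rightarrow> bool" where
  "descending_chain R C \<longleftrightarrow> (\<forall>y\<in>C. finite {x \<in> C. (y, x) \<in> R})"

definition SADC :: problem where
  "SADC f = {indicator C | L R C. f = order_code L R \<and> SADC_input L R \<and>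
     C \<subseteq> L \<and> infinite C \<and> (ascending_chain R C \<or> descending_chain R C)}"

lemma order_code_inject: "order_code L R = order_code L' R' \<longleftrightarrow> L = L' \<and> R = R'"
  by (auto simp: order_code_def join_inject indicator_inject inj_image_eq_iff[OF inj_prod_encode])

lemma pdom_SADC: "pdom SADC = {order_code L R | L R. SADC_input L R}"
proof -
  have "\<exists>C. C \<subseteq> L \<and> infinite C \<and> (ascending_chain R C \<or> descending_chain R C)"
    if "SADC_input L R" for L R
  proof -
    from that obtain h where h: "bij_betw h L UNIV"
      and R: "\<And>x y. x \<in> L \<Longrightarrow> y \<in> L \<Longrightarrow> (x, y) \<in> R \<longleftrightarrow> less_omega_omega_star (h x) (h y)"
      unfolding SADC_input_def order_type_omega_omega_star_def by blast
    define k where "k = inv_into L h"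
    have hk: "h (k z) = z" and kL: "k z \<in> L" for z
      using h by (auto simp: k_def bij_betw_def f_inv_into_f inv_into_into)
    have "inj (k \<circ> Inl)"
      by (rule injI) (metis comp_apply hk sum.inject(1))
    then have "infinite (range (k \<circ> Inl))"
      using finite_imageD by blast
    moreover have "ascending_chain R (range (k \<circ> Inl))"
      unfolding ascending_chain_def
    proof
      fix y assume "y \<in> range (k \<circ> Inl)"
      then obtain n where "y = k (Inl n)" by auto
      then have "{x \<in> range (k \<circ> Inl). (x, y) \<in> R} \<subseteq> (k \<circ> Inl) ` {..<n}"
        by (auto simp: R kL hk)
      then show "finite {x \<in> range (k \<circ> Inl). (x, y) \<in> R}"
        by (rule finite_subset) simp
    qed
    ultimately show ?thesis
      using kL by (intro exI[of _ "range (k \<circ> Inl)"]) auto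
  qed
  note ex = this
  show ?thesis
  proof (intro set_eqI iffI)
    fix f assume "f \<in> pdom SADC"
    then show "f \<in> {order_code L R | L R. SADC_input L R}"
      unfolding pdom_def SADC_def by fast
  next
    fix f assume "f \<in> {order_code L R | L R. SADC_input L R}"
    then obtain L R where f: "f = order_code L R" and LR: "SADC_input L R" by fast
    from ex[OF LR] obtain C where C: "C \<subseteq> L" "infinite C"
      "ascending_chain R C \<or> descending_chain R C"
      by (elim exE conjE)
    have "indicator C \<in> SADC f"
      unfolding SADC_def mem_Collect_eq
      by (rule exI[of _ L], rule exI[of _ R], rule exI[of _ C]) (simp only: f LR C simp_thms)
    then show "f \<in> pdom SADC"
      by (auto simp: pdom_def)
  qed
qed

section \<open>The weak Rival--Sands theorem for graphs\<close>

definition neighbours :: "nat set set \<Rightarrow> nat \<Rightarrow> nat set" where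
  "neighbours E v = {y. {v, y} \<in> E}"

definition graph_code :: "nat set \<Rightarrow> nat set set \<Rightarrow> baire" where
  "graph_code V E = join (indicator V) (indicator {prod_encode (x, y) | x y. {x, y} \<in> E})"

definition wRSgr_input :: "nat set \<Rightarrow> nat set set \<Rightarrow> bool" where
  "wRSgr_input V E \<longleftrightarrow> infinite V \<and> E \<subseteq> [V]\<^bsup>2\<^esup>"

definition wRSgr :: problem where
  "wRSgr f = {indicator H | V E H. f = graph_code V E \<and> wRSgr_input V E \<and>
     H \<subseteq> V \<and> infinite H \<and>
     (\<forall>v\<in>H. infinite (H \<inter> neighbours E v) \<or> H \<inter> neighbours E v = {})}"

lemma graph_code_inject:
  assumes "E \<subseteq> [V]\<^bsup>2\<^esup>" "E' \<subseteq> [V']\<^bsup>2\<^esup>"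
  shows "graph_code V E = graph_code V' E' \<longleftrightarrow> V = V' \<and> E = E'"
proof
  assume "graph_code V E = graph_code V' E'"
  then have V: "V = V'"
    and eq: "{prod_encode (x, y) | x y. {x, y} \<in> E} = {prod_encode (x, y) | x y. {x, y} \<in> E'}"
    by (auto simp: graph_code_def join_inject indicator_inject)
  have "{x, y} \<in> E \<longleftrightarrow> {x, y} \<in> E'" for x y
    using eq[unfolded set_eq_iff, rule_format, of "prod_encode (x, y)"] by simp
  then have "E = E'"
    using assms by (metis nsets2_E subset_antisym subset_eq)
  with V show "V = V' \<and> E = E'" by simp
qed simp

lemma pdom_wRSgr: "pdom wRSgr = {graph_code V E | V E. wRSgr_input V E}"
proof -
  have "\<exists>H. H \<subseteq> V \<and> infinite H \<and>
      (\<forall>v\<in>H. infinite (H \<inter> neighbours E v) \<or> H \<inter> neighbours E v = {})"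
    if "wRSgr_input V E" for V E
  proof -
    from that have V: "infinite V" and E: "E \<subseteq> [V]\<^bsup>2\<^esup>"
      by (auto simp: wRSgr_input_def)
    have "\<forall>x\<in>V. \<forall>y\<in>V. x \<noteq> y \<longrightarrow> of_bool ({x, y} \<in> E) < (2 :: nat)"
      by (simp add: of_bool_def)
    from Ramsey2[OF V this] obtain H t where H: "H \<subseteq> V" "infinite H"
      and t: "\<forall>x\<in>H. \<forall>y\<in>H. x \<noteq> y \<longrightarrow> of_bool ({x, y} \<in> E) = (t :: nat)"
      by (elim exE conjE)
    have irr: "{x} \<notin> E" for x
      using E by (auto simp: nsets_def)
    have "infinite (H \<inter> neighbours E v) \<or> H \<inter> neighbours E v = {}" if v: "v \<in> H" for v
    proof (cases "t = 0")
      case True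
      have "{v, y} \<notin> E" if "y \<in> H" for y
        using t[rule_format, OF v that] irr[of v] True by (cases "v = y") auto
      then show ?thesis by (auto simp: neighbours_def)
    next
      case False
      have "{v, y} \<in> E" if "y \<in> H - {v}" for y
        using t[rule_format, of v y] v that False by (auto split: if_splits)
      then have "H - {v} \<subseteq> H \<inter> neighbours E v" by (auto simp: neighbours_def)
      moreover have "infinite (H - {v})" using H(2) by simp
      ultimately show ?thesis using finite_subset by blast
    qed
    with H show ?thesis by blast
  qed
  note ex = this
  show ?thesis
  proof (intro set_eqI iffI)
    fix f assume "f \<in> pdom wRSgr"
    then show "f \<in> {graph_code V E | V E. wRSgr_input V E}"
      unfolding pdom_def wRSgr_def by fast
  next
    fix f assume "f \<in> {graph_code V E | V E. wRSgr_input V E}"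
    then obtain V E where f: "f = graph_code V E" and VE: "wRSgr_input V E" by fast
    from ex[OF VE] obtain H where H: "H \<subseteq> V" "infinite H"
      "\<forall>v\<in>H. infinite (H \<inter> neighbours E v) \<or> H \<inter> neighbours E v = {}"
      by (elim exE conjE)
    have "indicator H \<in> wRSgr f"
      unfolding wRSgr_def mem_Collect_eq
      by (rule exI[of _ V], rule exI[of _ E], rule exI[of _ H]) (use f VE H in simp)
    then show "f \<in> pdom wRSgr"
      by (auto simp: pdom_def)
  qed
qed

end

theory Submission
  imports Defs
begin

text \<open>
  Only continuity of the two functionals matters. An order of type \<open>\<omega> + \<omega>\<^sup>*\<close> on the natural
  numbers is a bijection from \<open>nat + nat\<close>, and finite initial segments of both halves serve as
  forcing conditions. The elements of a finite piece of the order that are not yet decided can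
  all be moved to either side of the cut without changing that piece.

  If some condition forces almost all vertices of the computed graph to have infinite degree,
  then generically every cofinite set of vertices is a solution, and outputs on both sides of the cut
  can be produced. Otherwise, a condition makes a finite independent set \<open>\<tau>\<^sub>0\<close> of vertices of finite
  degree produce an output \<open>x\<close>, say in the \<open>\<omega>\<close>-part. From now on, new outputs are moved to the
  \<open>\<omega>\<^sup>*\<close>-part. A finite independent set \<open>\<tau>\<close> for which \<open>\<tau>\<^sub>0 \<union> \<tau>\<close> has such a wrong output does not
  extend to a solution, so almost every vertex has a neighbour in \<open>\<tau>\<close>. As in Seetapun's argument,
  compactness provides finitely many such sets \<open>\<tau>\<close> such that, in addition, every set meeting all of
  them contains a set with a wrong output. Repeating this yields such sets \<open>\<tau>\<close> arbitrarily far out,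
  and their union then contains a set \<open>Y\<close> that meets all of them and in which every vertex has
  infinite degree. A finite subset of \<open>Y\<close> with a wrong output and a tail of \<open>Y\<close> now form a solution
  together with \<open>\<tau>\<^sub>0\<close>.
\<close>

section \<open>Continuity of oracle computations\<close>

lemma finite_uniform_bound:
  fixes Q :: "'a \<Rightarrow> nat \<Rightarrow> bool"
  assumes "finite F" and "\<And>x. x \<in> F \<Longrightarrow> \<exists>u. Q x u"
    and mono: "\<And>x u v. Q x u \<Longrightarrow> u \<le> v \<Longrightarrow> Q x v"
  shows "\<exists>u. \<forall>x\<in>F. Q x u"
  using assms(1,2)
proof (induction F rule: finite_induct)
  case (insert x F)
  then obtain u v where "\<forall>x\<in>F. Q x u" "Q x v" by (metis insertCI)
  then have "\<forall>y\<in>insert x F. Q y (max u v)" by (auto intro: mono)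
  then show ?case ..
qed simp

text \<open>A halting computation is a finite derivation, so it consults only finitely many oracle
  values; the use of a composite computation is the maximum of the uses of its parts.\<close>

lemma evals_use:
  "evals f p xs z \<Longrightarrow> \<exists>u. \<forall>g. (\<forall>i<u. g i = f i) \<longrightarrow> evals g p xs z"
proof (induction rule: evals.induct)
  case (query x xs)
  have "\<forall>g. (\<forall>i<Suc x. g i = f i) \<longrightarrow> evals g Query (x # xs) (f x)"
    using evals.query by (metis lessI)
  then show ?case ..
next
  case (comp xs qs ys p z)
  let ?Q = "\<lambda>i u. \<forall>g. (\<forall>j<u. g j = f j) \<longrightarrow> evals g (qs ! i) xs (ys ! i)"
  have len: "length qs = length ys"
    using comp by (simp add: list_all2_lengthD)
  have "\<exists>u. \<forall>i\<in>{..<length qs}. ?Q i u"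
    using comp.IH(1) by (intro finite_uniform_bound) (auto simp: list_all2_conv_all_nth)
  then obtain u where u: "\<forall>i\<in>{..<length qs}. ?Q i u" ..
  obtain v where v: "\<forall>g. (\<forall>j<v. g j = f j) \<longrightarrow> evals g p ys z"
    using comp.IH(2) by blast
  have "\<forall>g. (\<forall>j<max u v. g j = f j) \<longrightarrow> evals g (Comp p qs) xs z"
  proof (intro allI impI)
    fix g :: baire assume g: "\<forall>j<max u v. g j = f j"
    show "evals g (Comp p qs) xs z"
      by (rule evals.comp[of g xs qs ys]) (use u v g len in \<open>auto simp: list_all2_conv_all_nth\<close>)
  qed
  then show ?case ..
next
  case (primrec_0 p xs y q)
  then obtain u where "\<forall>g. (\<forall>j<u. g j = f j) \<longrightarrow> evals g p xs y" by blast
  then have "\<forall>g. (\<forall>j<u. g j = f j) \<longrightarrow> evals g (PrimRec p q) (0 # xs) y"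
    by (simp add: evals.primrec_0)
  then show ?case ..
next
  case (primrec_Suc p q n xs y z)
  then obtain u v where "\<forall>g. (\<forall>j<u. g j = f j) \<longrightarrow> evals g (PrimRec p q) (n # xs) y"
    "\<forall>g. (\<forall>j<v. g j = f j) \<longrightarrow> evals g q (n # y # xs) z" by blast
  then have "\<forall>g. (\<forall>j<max u v. g j = f j) \<longrightarrow> evals g (PrimRec p q) (Suc n # xs) z"
    by (auto intro: evals.primrec_Suc[where y = y])
  then show ?case ..
next
  case (mu p n xs)
  let ?Q = "\<lambda>m u. \<forall>g. (\<forall>j<u. g j = f j) \<longrightarrow> (\<exists>y. evals g p (m # xs) (Suc y))"
  have "\<exists>u. \<forall>m\<in>{..<n}. ?Q m u"
    proof (rule finite_uniform_bound)
    fix m assume "m \<in> {..<n}"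
    then obtain y u where "\<forall>g. (\<forall>j<u. g j = f j) \<longrightarrow> evals g p (m # xs) (Suc y)"
      using mu.IH(2) by auto
    then show "\<exists>u. ?Q m u" by (intro exI[of _ u]) blast
  qed auto
  then obtain u where u: "\<forall>m\<in>{..<n}. ?Q m u" ..
  obtain v where v: "\<forall>g. (\<forall>j<v. g j = f j) \<longrightarrow> evals g p (n # xs) 0"
    using mu.IH(1) by blast
  have "\<forall>g. (\<forall>j<max u v. g j = f j) \<longrightarrow> evals g (Mu p) xs n"
    using u v by (intro allI impI evals.mu) auto
  then show ?case ..
qed (auto intro!: evals.intros)

section \<open>Orders of type \<open>\<omega> + \<omega>\<^sup>*\<close> on the natural numbers\<close>

text \<open>For a bijection \<open>k\<close>, \<open>k (Inl i)\<close> is the \<open>i\<close>-th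
  element from the bottom and \<open>k (Inr i)\<close> the \<open>i\<close>-th from the top, both
  counted from 0.\<close>

type_synonym enum = "nat + nat \<Rightarrow> nat"

definition seg :: "nat \<Rightarrow> (nat + nat) set" where
  "seg n = Inl ` {..<n} \<union> Inr ` {..<n}"

lemma seg_simps [simp]: "Inl i \<in> seg n \<longleftrightarrow> i < n" "Inr i \<in> seg n \<longleftrightarrow> i < n"
  by (auto simp: seg_def)

lemma finite_seg [simp]: "finite (seg n)"
  by (simp add: seg_def)

lemma seg_mono: "m \<le> n \<Longrightarrow> seg m \<subseteq> seg n"
  by (auto simp: seg_def)

text \<open>The forcing condition \<open>(n, k)\<close> is the restriction of \<open>k\<close> to
  \<open>seg n\<close>; this is the set of its total extensions. They agree on positions, hence on
  sides of the cut.\<close>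

definition nbhd :: "nat \<Rightarrow> enum \<Rightarrow> enum set" where
  "nbhd n k = {k'. bij k' \<and> (\<forall>u\<in>seg n. k' u = k u)}"

definition ord :: "enum \<Rightarrow> (nat \<times> nat) set" where
  "ord k = {(k u, k v) | u v. less_omega_omega_star u v}"

definition low :: "enum \<Rightarrow> nat \<Rightarrow> bool" where
  "low k x \<longleftrightarrow> x \<in> range (k \<circ> Inl)"

text \<open>All that a computation with use \<open>u\<close> can see of the order. Positions are
  left open, so \<open>near\<close> orders may put the same number on different sides of the
  cut.\<close>

definition near :: "nat \<Rightarrow> enum \<Rightarrow> enum \<Rightarrow> bool" where
  "near u k k' \<longleftrightarrow> (\<forall>x<u. \<forall>y<u. (x, y) \<in> ord k' \<longleftrightarrow> (x, y) \<in> ord k)"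

lemma nbhd_bij: "k' \<in> nbhd n k \<Longrightarrow> bij k'"
  by (simp add: nbhd_def)

lemma nbhd_refl: "bij k \<Longrightarrow> k \<in> nbhd n k"
  by (simp add: nbhd_def)

lemma nbhd_trans: "k' \<in> nbhd n k \<Longrightarrow> k'' \<in> nbhd n' k' \<Longrightarrow> n \<le> n' \<Longrightarrow> k'' \<in> nbhd n k"
  using seg_mono[of n n'] by (auto simp: nbhd_def)

lemma nbhd_antimono: "k' \<in> nbhd n' k \<Longrightarrow> n \<le> n' \<Longrightarrow> k' \<in> nbhd n k"
  using seg_mono[of n n'] by (auto simp: nbhd_def)

lemma near_refl: "near u k k"
  by (simp add: near_def)

lemma near_trans: "near u k k' \<Longrightarrow> near u k' k'' \<Longrightarrow> near u k k''"
  by (simp add: near_def)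

lemma near_antimono: "near v k k' \<Longrightarrow> u \<le> v \<Longrightarrow> near u k k'"
  by (simp add: near_def)

lemma ord_iff: "bij k \<Longrightarrow> (k u, k v) \<in> ord k \<longleftrightarrow> less_omega_omega_star u v"
  by (auto simp: ord_def bij_def inj_eq)

lemma low_simps:
  assumes "bij k" shows "low k (k (Inl i))" "\<not> low k (k (Inr i))"
  using assms by (auto simp: low_def bij_def inj_eq)

lemma low_nbhd:
  assumes "bij k" "k' \<in> nbhd n k" "x \<in> k ` seg n"
  shows "low k' x \<longleftrightarrow> low k x"
proof -
  obtain u where u: "u \<in> seg n" "x = k u" using assms(3) by blast
  then have "x = k' u" using assms(2) by (simp add: nbhd_def)
  then show ?thesis
    using u assms(1) nbhd_bij[OF assms(2)] by (cases u) (metis low_simps(1), metis low_simps(2))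
qed

lemma seg_covers:
  assumes "bij (k :: enum)"
  shows "\<exists>n. {..<u} \<subseteq> k ` seg n"
proof -
  have "\<exists>n. \<forall>x\<in>{..<u}. x \<in> k ` seg n"
  proof (rule finite_uniform_bound)
    fix x
    obtain w where "x = k w" using assms by (metis bij_pointE)
    then have "x \<in> k ` seg (Suc (case w of Inl i \<Rightarrow> i | Inr i \<Rightarrow> i))"
      by (cases w) auto
    then show "\<exists>n. x \<in> k ` seg n" ..
  qed (use seg_mono in blast)+
  then show ?thesis by blast
qed

lemma nbhd_near:
  assumes "bij k" "{..<u} \<subseteq> k ` seg n" "k' \<in> nbhd n k"
  shows "near u k k'"
  unfolding near_def
proof (intro allI impI)
  fix x y assume "x < u" "y < u"
  then obtain v w where vw: "v \<in> seg n" "w \<in> seg n" "x = k v" "y = k w"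
    using assms(2) by blast
  then have "x = k' v" "y = k' w" using assms(3) by (simp_all add: nbhd_def)
  then show "(x, y) \<in> ord k' \<longleftrightarrow> (x, y) \<in> ord k"
    using vw assms(1) nbhd_bij[OF assms(3)] by (metis ord_iff)
qed

text \<open>Every number below \<open>u\<close> is enumerated at a finite stage of \<open>k\<close>;
  from then on its position, and so its side, is fixed.\<close>

lemma determine:
  assumes "bij k"
  shows "\<exists>n'\<ge>n. {..<u} \<subseteq> k ` seg n' \<and>
    (\<forall>k'\<in>nbhd n' k. near u k k' \<and> (\<forall>x<u. low k' x \<longleftrightarrow> low k x))"
proof -
  obtain n1 where "{..<u} \<subseteq> k ` seg n1" using seg_covers[OF assms] by blast
  then have *: "{..<u} \<subseteq> k ` seg (max n n1)"
    using seg_mono[of n1 "max n n1"] by auto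
  show ?thesis
    by (rule exI[of _ "max n n1"])
      (use * in \<open>auto intro: nbhd_near[OF assms] simp: low_nbhd[OF assms] subset_iff\<close>)
qed

text \<open>
  The entries \<open>a\<^sub>n, \<dots>, a\<^bsub>m-1\<^esub>\<close> of the \<open>\<omega>\<close>-part are moved in front of the first \<open>m\<close> entries
  of the \<open>\<omega>\<^sup>*\<close>-part; this does not affect the order of the elements enumerated so far.
\<close>

lemma flip_high:
  assumes k: "bij k"
  shows "\<exists>k'\<in>nbhd n k. near u k k' \<and> (\<forall>x<u. x \<notin> k ` seg n \<longrightarrow> \<not> low k' x)"
proof -
  obtain m where m: "n \<le> m" "{..<u} \<subseteq> k ` seg m"
    using determine[OF k, of n u] by blast
  \<comment> \<open>\<open>\<pi>\<close> tells which old position fills a new one, and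
    \<open>\<rho>\<close> where an old entry goes. The index of a moved entry is reflected to
    \<open>2 * m - 1 - i\<close> because \<open>Inr\<close> positions are counted from the
    top.\<close>
  define \<pi> :: "nat + nat \<Rightarrow> nat + nat" where "\<pi> w = (case w of
      Inl i \<Rightarrow> if i < n then Inl i else Inl (i + (m - n))
    | Inr i \<Rightarrow> if i < m then Inr i else if i < 2 * m - n then Inl (2 * m - 1 - i)
               else Inr (i - (m - n)))" for w
  define \<rho> :: "nat + nat \<Rightarrow> nat + nat" where "\<rho> w = (case w of
      Inl i \<Rightarrow> if i < n then Inl i else if i < m then Inr (2 * m - 1 - i) else Inl (i - (m - n))
    | Inr i \<Rightarrow> if i < m then Inr i else Inr (i + (m - n)))" for w
  have inv: "\<rho> (\<pi> w) = w" "\<pi> (\<rho> w) = w" for w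
    using m(1) by (cases w; auto simp: \<pi>_def \<rho>_def)+
  have "bij \<pi>"
    by (rule o_bij[of \<rho>]) (auto simp: inv)
  then have bij: "bij (k \<circ> \<pi>)"
    using k by (rule bij_comp)
  have nb: "k \<circ> \<pi> \<in> nbhd n k"
    using bij m(1) by (auto simp: nbhd_def seg_def \<pi>_def)
  \<comment> \<open>Only positions in \<open>seg m\<close> keep their order: an entry
    \<open>Inl i\<close> with \<open>m \<le> i\<close> stays in the left half and so falls below the
    moved ones.\<close>
  have less: "less_omega_omega_star (\<rho> v) (\<rho> w) \<longleftrightarrow> less_omega_omega_star v w"
    if "v \<in> seg m" "w \<in> seg m" for v w
    using that m(1) by (cases v; cases w) (auto simp: \<rho>_def)
  have near: "near u k (k \<circ> \<pi>)"
    unfolding near_def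
  proof (intro allI impI)
    fix x y assume "x < u" "y < u"
    then obtain v w where vw: "v \<in> seg m" "w \<in> seg m" "x = k v" "y = k w"
      using m(2) by blast
    then have "x = (k \<circ> \<pi>) (\<rho> v)" "y = (k \<circ> \<pi>) (\<rho> w)" by (simp_all add: inv)
    then show "(x, y) \<in> ord (k \<circ> \<pi>) \<longleftrightarrow> (x, y) \<in> ord k"
      using vw less ord_iff[OF k] ord_iff[OF bij] by metis
  qed
  have "\<not> low (k \<circ> \<pi>) x" if x: "x < u" "x \<notin> k ` seg n" for x
  proof -
    obtain w where w: "w \<in> seg m" "x = k w" using x m(2) by blast
    then have "w \<notin> seg n" using x by blast
    then obtain i where "\<rho> w = Inr i"
      using w(1) by (cases w) (auto simp: \<rho>_def)
    then have "x = (k \<circ> \<pi>) (Inr i)"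
      using w by (metis comp_apply inv(2))
    then show ?thesis using low_simps(2)[OF bij] by simp
  qed
  with nb near show ?thesis by blast
qed

text \<open>Exchanging the halves reverses the order, so that facts about one side of the cut
  transfer to the other.\<close>

definition swap_sum :: "nat + nat \<Rightarrow> nat + nat" where
  "swap_sum = case_sum Inr Inl"

lemma swap_sum_simps [simp]: "swap_sum (Inl i) = Inr i" "swap_sum (Inr i) = Inl i"
  by (simp_all add: swap_sum_def)

lemma swap_sum_swap_sum [simp]: "swap_sum (swap_sum w) = w"
  by (cases w) auto

lemma bij_swap_sum: "bij swap_sum"
  by (rule o_bij[of swap_sum]) auto

lemma swap_sum_seg: "swap_sum w \<in> seg n \<longleftrightarrow> w \<in> seg n"
  by (cases w) auto

lemma image_swap_seg: "(k \<circ> swap_sum) ` seg n = k ` seg n"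
  by (auto simp: image_iff swap_sum_seg) (metis swap_sum_seg swap_sum_swap_sum)

lemma swap_less: "less_omega_omega_star (swap_sum v) (swap_sum w) \<longleftrightarrow> less_omega_omega_star w v"
  by (cases v; cases w) auto

lemma ord_swap: "(x, y) \<in> ord (k \<circ> swap_sum) \<longleftrightarrow> (y, x) \<in> ord k"
  unfolding ord_def by (auto simp: swap_less) (metis swap_less swap_sum_swap_sum)+

lemma low_swap:
  assumes "bij k" shows "low (k \<circ> swap_sum) x \<longleftrightarrow> \<not> low k x"
proof -
  obtain w where "x = k w" using assms by (metis bij_pointE)
  moreover have "bij (k \<circ> swap_sum)" using bij_swap_sum assms by (rule bij_comp)
  ultimately show ?thesis
    using low_simps[OF assms] low_simps[of "k \<circ> swap_sum"] by (cases w) auto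
qed

text \<open>\<open>flip_high\<close> makes the undecided elements high; applied to the reversed
  order and reversed back, it makes them low.\<close>

lemma flip:
  assumes k: "bij k"
  shows "\<exists>k'\<in>nbhd n k. near u k k' \<and> (\<forall>x<u. x \<notin> k ` seg n \<longrightarrow> (low k' x \<longleftrightarrow> d))"
proof (cases d)
  case False
  then show ?thesis using flip_high[OF k, of n u] by simp
next
  case True
  have "bij (k \<circ> swap_sum)" using bij_swap_sum k by (rule bij_comp)
  from flip_high[OF this, of n u] obtain k' where k': "k' \<in> nbhd n (k \<circ> swap_sum)"
    "near u (k \<circ> swap_sum) k'" "\<forall>x<u. x \<notin> k ` seg n \<longrightarrow> \<not> low k' x"
    unfolding image_swap_seg by blast
  have "bij (k' \<circ> swap_sum)" using bij_swap_sum nbhd_bij[OF k'(1)] by (rule bij_comp)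
  then have "k' \<circ> swap_sum \<in> nbhd n k"
    using k'(1) by (auto simp: nbhd_def swap_sum_seg)
  moreover have "near u k (k' \<circ> swap_sum)"
    using k'(2) by (auto simp: near_def ord_swap)
  ultimately show ?thesis
    using k'(3) True low_swap[OF nbhd_bij[OF k'(1)]] by blast
qed

text \<open>A Baire category argument: below the given condition each \<open>C m\<close> contains a
  dense open set of orders, so a decreasing sequence of conditions can meet them all, and its limit
  is the order sought.\<close>

lemma fusion:
  fixes C :: "nat \<Rightarrow> enum \<Rightarrow> bool"
  assumes k0: "bij k0"
    and dense: "\<And>m k n. k \<in> nbhd n0 k0 \<Longrightarrow> n0 \<le> n \<Longrightarrow>
      \<exists>k'\<in>nbhd n k. \<exists>n'\<ge>n. \<forall>k''\<in>nbhd n' k'. C m k''"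
  shows "\<exists>k\<in>nbhd n0 k0. \<forall>m. C m k"
proof -
  let ?A = "\<lambda>i s. fst s \<in> nbhd n0 k0 \<and> n0 \<le> snd s \<and> i \<le> snd s"
  \<comment> \<open>Putting \<open>i\<close> into the image at step \<open>i\<close> makes the limit
    surjective.\<close>
  let ?S = "\<lambda>i s t. fst t \<in> nbhd (snd s) (fst s) \<and> snd s \<le> snd t \<and> i \<in> fst t ` seg (snd t) \<and>
    (\<forall>k''\<in>nbhd (snd t) (fst t). C i k'')"
  have step: "\<exists>t. ?A (Suc i) t \<and> ?S i s t" if s: "?A i s" for i :: nat and s :: "enum \<times> nat"
  proof -
    obtain k' n' where k': "k' \<in> nbhd (snd s) (fst s)" "n' \<ge> snd s" "\<forall>k''\<in>nbhd n' k'. C i k''"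
      using dense[of "fst s" "snd s" i] s by blast
    obtain n where n: "max n' (Suc i) \<le> n" "{..<Suc i} \<subseteq> k' ` seg n"
      using determine[OF nbhd_bij[OF k'(1)]] by blast
    have "?A (Suc i) (k', n) \<and> ?S i s (k', n)"
      using s k' n nbhd_trans[OF _ k'(1), of n0 k0] by (auto intro: nbhd_antimono)
    then show ?thesis by blast
  qed
  have start: "\<exists>s. ?A 0 s" using k0 by (intro exI[of _ "(k0, n0)"]) (simp add: nbhd_refl)
  have "\<exists>s. \<forall>i. ?A i (s i) \<and> ?S i (s i) (s (Suc i))"
    using start step by (rule dependent_nat_choice)
  then obtain s where s: "\<And>i. ?A i (s i)" "\<And>i. ?S i (s i) (s (Suc i))"
    by blast
  define K where "K i = fst (s i)" for i
  define N where "N i = snd (s i)" for i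
  have K: "K i \<in> nbhd n0 k0" "n0 \<le> N i" "i \<le> N i" "K (Suc i) \<in> nbhd (N i) (K i)" "N i \<le> N (Suc i)"
    "i \<in> K (Suc i) ` seg (N (Suc i))" "\<forall>k''\<in>nbhd (N (Suc i)) (K (Suc i)). C i k''" for i
    using s unfolding K_def N_def by auto
  have coh: "i \<le> j \<Longrightarrow> K j \<in> nbhd (N i) (K i) \<and> N i \<le> N j" for i j
  proof (induction j rule: dec_induct)
    case base
    then show ?case using K(1) by (simp add: nbhd_refl nbhd_bij[of "K i" n0 k0])
  next
    case (step j)
    then show ?case using K(4,5)[of j] nbhd_trans le_trans by meson
  qed
  \<comment> \<open>The value at \<open>Inl i\<close> or \<open>Inr i\<close> is read off at stage
    \<open>Suc i\<close>, where \<open>i < Suc i \<le> N (Suc i)\<close> shows that this position is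
    already fixed.\<close>
  define k where "k w = K (Suc (case w of Inl i \<Rightarrow> i | Inr i \<Rightarrow> i)) w" for w
  have kK: "k w = K j w" if "w \<in> seg (N j)" for w j
  proof -
    let ?i = "Suc (case w of Inl i \<Rightarrow> i | Inr i \<Rightarrow> i)"
    have "w \<in> seg (N ?i)" using K(3)[of ?i] by (cases w) auto
    then show ?thesis
      using that coh[of j ?i] coh[of ?i j] by (cases "j \<le> ?i") (auto simp: k_def nbhd_def)
  qed
  have seg: "\<exists>j. v \<in> seg (N j) \<and> w \<in> seg (N j)" for v w
  proof -
    let ?j = "Suc (case v of Inl i \<Rightarrow> i | Inr i \<Rightarrow> i) + Suc (case w of Inl i \<Rightarrow> i | Inr i \<Rightarrow> i)"
    have "v \<in> seg (N ?j) \<and> w \<in> seg (N ?j)" using K(3)[of ?j] by (cases v; cases w) auto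
    then show ?thesis ..
  qed
  have "bij k"
  proof (rule bijI)
    show "inj k"
    proof (rule injI)
      fix v w assume "k v = k w"
      moreover obtain j where "v \<in> seg (N j)" "w \<in> seg (N j)" using seg by blast
      ultimately have "K j v = K j w" by (simp add: kK)
      moreover have "inj (K j)" using nbhd_bij[OF K(1)] by (simp add: bij_def)
      ultimately show "v = w" by (simp add: inj_eq)
    qed
    have "x \<in> range k" for x
    proof -
      obtain w where "w \<in> seg (N (Suc x))" "x = K (Suc x) w" using K(6)[of x] by blast
      then show ?thesis using kK[of w "Suc x"] by (simp add: image_iff) metis
    qed
    then show "surj k" by blast
  qed
  then have nb: "k \<in> nbhd (N i) (K i)" for i
    by (simp add: nbhd_def kK)
  have "k \<in> nbhd n0 k0" by (rule nbhd_trans[OF K(1) nb K(2)[of 0]])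
  moreover have "C m k" for m using K(7)[of m] nb by blast
  ultimately show ?thesis by blast
qed

section \<open>Inside-homogeneous sets of vertices\<close>

text \<open>The solution condition of \<open>wRSgr\<close>, with the edges given as a
  relation.\<close>

definition sol :: "nat set \<Rightarrow> (nat \<Rightarrow> nat \<Rightarrow> bool) \<Rightarrow> nat set \<Rightarrow> bool" where
  "sol V E X \<longleftrightarrow> X \<subseteq> V \<and> infinite X \<and> (\<forall>v\<in>X. infinite {w \<in> X. E v w} \<or> {w \<in> X. E v w} = {})"

definition indep :: "(nat \<Rightarrow> nat \<Rightarrow> bool) \<Rightarrow> nat set \<Rightarrow> bool" where
  "indep E X \<longleftrightarrow> (\<forall>v\<in>X. \<forall>w\<in>X. \<not> E v w)"

lemma sol_indep: "X \<subseteq> V \<Longrightarrow> infinite X \<Longrightarrow> indep E X \<Longrightarrow> sol V E X"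
  by (auto simp: sol_def indep_def)

lemma homogeneous_subset:
  assumes "infinite U" and sym: "\<And>v w. E v w \<Longrightarrow> E w v" and irr: "\<And>v. \<not> E v v"
  obtains X where "X \<subseteq> U" "infinite X" "indep E X \<or> (\<forall>v\<in>X. \<forall>w\<in>X. v \<noteq> w \<longrightarrow> E v w)"
proof -
  have "\<forall>x\<in>U. \<forall>y\<in>U. x \<noteq> y \<longrightarrow> of_bool (\<exists>v w. {v, w} = {x, y} \<and> E v w) < (2 :: nat)"
    by (simp add: of_bool_def)
  from Ramsey2[OF assms(1) this] obtain X t where X: "X \<subseteq> U" "infinite X"
    and t: "\<forall>x\<in>X. \<forall>y\<in>X. x \<noteq> y \<longrightarrow> of_bool (\<exists>v w. {v, w} = {x, y} \<and> E v w) = (t :: nat)"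
    by (elim exE conjE)
  have edge: "(\<exists>v w. {v, w} = {x, y} \<and> E v w) \<longleftrightarrow> E x y" for x y
    using sym by (auto simp: doubleton_eq_iff)
  have "indep E X \<or> (\<forall>v\<in>X. \<forall>w\<in>X. v \<noteq> w \<longrightarrow> E v w)"
  proof (cases "t = 0")
    case True
    then have "\<not> E v w" if "v \<in> X" "w \<in> X" for v w
      using t[rule_format, OF that] irr by (cases "v = w") (auto simp: edge)
    then show ?thesis by (auto simp: indep_def)
  next
    case False
    then have "E v w" if "v \<in> X" "w \<in> X" "v \<noteq> w" for v w
      using t[rule_format, OF that] by (auto simp: edge split: if_splits)
    then show ?thesis by blast
  qed
  with X show ?thesis using that by blast
qed

text \<open>By Ramsey's theorem: in an infinite clique all degrees are infinite, in an independent
  set they are zero.\<close>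

lemma sol_exists:
  assumes "infinite U" and "\<And>v w. E v w \<Longrightarrow> E w v" and "\<And>v. \<not> E v v"
  obtains X where "sol U E X"
proof -
  obtain X where X: "X \<subseteq> U" "infinite X" "indep E X \<or> (\<forall>v\<in>X. \<forall>w\<in>X. v \<noteq> w \<longrightarrow> E v w)"
    using homogeneous_subset[of U E] assms by blast
  from X(3) have "sol U E X"
  proof
    assume all: "\<forall>v\<in>X. \<forall>w\<in>X. v \<noteq> w \<longrightarrow> E v w"
    have "infinite {w \<in> X. E v w}" if "v \<in> X" for v
    proof -
      have "X - {v} \<subseteq> {w \<in> X. E v w}" using all that by auto
      moreover have "infinite (X - {v})" using X(2) by simp
      ultimately show ?thesis using finite_subset by blast
    qed
    then show ?thesis using X by (auto simp: sol_def)
  qed (use X sol_indep in blast)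
  then show ?thesis by (rule that)
qed

lemma sol_Un_isolated:
  assumes X: "sol V E X" and T: "T \<subseteq> V" "indep E T"
    and "\<And>v w. v \<in> T \<Longrightarrow> w \<in> X \<Longrightarrow> \<not> E v w" and sym: "\<And>v w. E v w \<Longrightarrow> E w v"
  shows "sol V E (T \<union> X)"
proof -
  have "infinite {w \<in> T \<union> X. E v w} \<or> {w \<in> T \<union> X. E v w} = {}" if "v \<in> T \<union> X" for v
  proof (cases "v \<in> T")
    case True
    then show ?thesis using T(2) assms(4) by (auto simp: indep_def)
  next
    case False
    with that have v: "v \<in> X" by blast
    then have eq: "{w \<in> T \<union> X. E v w} = {w \<in> X. E v w}"
      using assms(4) sym by blast
    show ?thesis unfolding eq using X v unfolding sol_def by blast
  qed
  moreover have "T \<union> X \<subseteq> V" "infinite (T \<union> X)" using X T(1) by (simp_all add: sol_def)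
  ultimately show ?thesis unfolding sol_def by blast
qed

lemma perfect_subset_of_dominating_family:
  fixes T :: "nat set set"
  assumes fin: "\<And>\<tau>. \<tau> \<in> T \<Longrightarrow> finite \<tau>"
    and dom: "\<And>\<tau>. \<tau> \<in> T \<Longrightarrow> finite {w \<in> \<Union>T. \<forall>v\<in>\<tau>. \<not> E v w}"
    and far: "\<And>m. \<exists>\<tau>\<in>T. \<tau> \<subseteq> {m..}"
    and ne: "\<And>\<tau>. \<tau> \<in> T \<Longrightarrow> \<tau> \<noteq> {}"
  obtains Y where "Y \<subseteq> \<Union>T" "infinite Y" "\<And>v. v \<in> Y \<Longrightarrow> infinite {w \<in> Y. E v w}"
    "\<And>\<tau>. \<tau> \<in> T \<Longrightarrow> \<tau> \<inter> Y \<noteq> {}"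
proof -
  \<comment> \<open>\<open>Q\<close> survives the removal of all vertices of finite degree, so a maximal \<open>Z\<close> leaves none.\<close>
  define Q where "Q Z \<longleftrightarrow> (\<forall>\<tau>\<in>T. \<tau> - Z \<noteq> {} \<and> finite {w \<in> \<Union>T - Z. \<forall>v\<in>\<tau> - Z. \<not> E v w})" for Z
  have "Q {}" using dom ne by (simp add: Q_def)
  have "\<exists>M\<in>Collect Q. \<forall>Z\<in>Collect Q. M \<subseteq> Z \<longrightarrow> Z = M"
  proof (rule subset_Zorn_nonempty)
    show "Collect Q \<noteq> {}" using \<open>Q {}\<close> by blast
  next
    fix \<C> assume C: "\<C> \<noteq> {}" "subset.chain (Collect Q) \<C>"
    have "\<tau> - \<Union>\<C> \<noteq> {} \<and> finite {w \<in> \<Union>T - \<Union>\<C>. \<forall>v\<in>\<tau> - \<Union>\<C>. \<not> E v w}" if \<tau>: "\<tau> \<in> T" for \<tau>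
    proof -
      \<comment> \<open>As \<open>\<tau>\<close> is finite, a single member of the chain already
        contains everything that the chain removes from \<open>\<tau>\<close>.\<close>
      have "finite (\<tau> \<inter> \<Union>\<C>)" "\<tau> \<inter> \<Union>\<C> \<subseteq> \<Union>\<C>" using fin[OF \<tau>] by auto
      then obtain Z where Z: "Z \<in> \<C>" "\<tau> \<inter> \<Union>\<C> \<subseteq> Z"
        using finite_subset_Union_chain[OF _ _ C] by blast
      then have eq: "\<tau> - Z = \<tau> - \<Union>\<C>" by blast
      have "Q Z" using C(2) Z(1) by (auto simp: subset.chain_def)
      then have *: "\<tau> - \<Union>\<C> \<noteq> {} \<and> finite {w \<in> \<Union>T - Z. \<forall>v\<in>\<tau> - \<Union>\<C>. \<not> E v w}"
        using \<tau> unfolding Q_def eq[symmetric] by (rule bspec)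
      have "{w \<in> \<Union>T - \<Union>\<C>. \<forall>v\<in>\<tau> - \<Union>\<C>. \<not> E v w} \<subseteq> {w \<in> \<Union>T - Z. \<forall>v\<in>\<tau> - \<Union>\<C>. \<not> E v w}"
        using Z(1) by blast
      with * show ?thesis using finite_subset by blast
    qed
    then show "\<Union>\<C> \<in> Collect Q" by (simp add: Q_def)
  qed
  then obtain Z where Z: "Q Z" and max: "\<And>Z'. Q Z' \<Longrightarrow> Z \<subseteq> Z' \<Longrightarrow> Z' = Z" by blast
  define Y where "Y = \<Union>T - Z"
  have meet: "\<tau> \<inter> Y \<noteq> {}" if "\<tau> \<in> T" for \<tau>
    using Z that by (auto simp: Q_def Y_def)
  have inf: "infinite Y"
    unfolding infinite_nat_iff_unbounded_le
  proof
    fix m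
    obtain \<tau> where "\<tau> \<in> T" "\<tau> \<subseteq> {m..}" using far by blast
    then show "\<exists>n\<ge>m. n \<in> Y" using meet by fastforce
  qed
  define Z' where "Z' = Z \<union> {v \<in> Y. finite {w \<in> Y. E v w}}"
  have "Q Z'"
    unfolding Q_def
  proof
    fix \<tau> assume \<tau>: "\<tau> \<in> T"
    \<comment> \<open>A vertex that \<open>\<tau>\<close> dominated before this removal but not
      after it is adjacent to one of the finitely many vertices of \<open>\<tau>\<close> with finite
      degree in \<open>Y\<close>.\<close>
    have sub: "{w \<in> Y. \<forall>v\<in>\<tau> - Z'. \<not> E v w} \<subseteq>
        {w \<in> \<Union>T - Z. \<forall>v\<in>\<tau> - Z. \<not> E v w} \<union> (\<Union>v\<in>{v \<in> \<tau>. finite {w \<in> Y. E v w}}. {w \<in> Y. E v w})"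
      by (auto simp: Y_def Z'_def)
    have "finite {w \<in> \<Union>T - Z. \<forall>v\<in>\<tau> - Z. \<not> E v w}"
      using Z \<tau> by (simp add: Q_def)
    moreover have "finite (\<Union>v\<in>{v \<in> \<tau>. finite {w \<in> Y. E v w}}. {w \<in> Y. E v w})"
      using fin[OF \<tau>] by simp
    ultimately have f: "finite {w \<in> Y. \<forall>v\<in>\<tau> - Z'. \<not> E v w}"
      using sub by (meson finite_UnI finite_subset)
    have "\<tau> - Z' \<noteq> {}"
    proof
      assume "\<tau> - Z' = {}"
      then have "{w \<in> Y. \<forall>v\<in>\<tau> - Z'. \<not> E v w} = Y" by blast
      with f inf show False by simp
    qed
    moreover have "{w \<in> \<Union>T - Z'. \<forall>v\<in>\<tau> - Z'. \<not> E v w} \<subseteq> {w \<in> Y. \<forall>v\<in>\<tau> - Z'. \<not> E v w}"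
      by (auto simp: Y_def Z'_def)
    ultimately show "\<tau> - Z' \<noteq> {} \<and> finite {w \<in> \<Union>T - Z'. \<forall>v\<in>\<tau> - Z'. \<not> E v w}"
      using f finite_subset by blast
  qed
  then have "Z' = Z" by (rule max) (auto simp: Z'_def)
  then have "infinite {w \<in> Y. E v w}" if "v \<in> Y" for v
    using that by (auto simp: Z'_def Y_def)
  with inf meet show ?thesis by (intro that[of Y]) (auto simp: Y_def)
qed

text \<open>Koenig's lemma for the tree of finite two-colourings of \<open>I\<close> without a monochromatic set in \<open>G\<close>.\<close>

lemma two_colouring_compactness:
  fixes I :: "nat set"
  assumes good: "\<And>R. R \<subseteq> I \<Longrightarrow> infinite R \<Longrightarrow> \<exists>\<rho>\<subseteq>R. finite \<rho> \<and> G \<rho>" and "infinite I"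
  shows "\<exists>N. \<forall>S\<subseteq>I. (\<exists>\<rho>\<subseteq>S \<inter> {..<N}. G \<rho>) \<or> (\<exists>\<rho>\<subseteq>(I - S) \<inter> {..<N}. G \<rho>)"
proof (rule ccontr)
  assume "\<not> ?thesis"
  then have "\<forall>N. \<exists>S\<subseteq>I. \<not> (\<exists>\<rho>\<subseteq>S \<inter> {..<N}. G \<rho>) \<and> \<not> (\<exists>\<rho>\<subseteq>(I - S) \<inter> {..<N}. G \<rho>)"
    by meson
  then obtain S where S: "\<And>N. S N \<subseteq> I" "\<And>N \<rho>. \<rho> \<subseteq> S N \<inter> {..<N} \<Longrightarrow> \<not> G \<rho>"
    "\<And>N \<rho>. \<rho> \<subseteq> (I - S N) \<inter> {..<N} \<Longrightarrow> \<not> G \<rho>"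
    by metis
  \<comment> \<open>\<open>S N\<close> is a colouring that defeats the bound \<open>N\<close>.
    \<open>?P N A\<close> makes \<open>A\<close> a node with infinitely many \<open>S r\<close>
    above it, hence with arbitrarily large \<open>r\<close>.\<close>
  let ?P = "\<lambda>N A. infinite {r. S r \<inter> {..<N} = A}"
  have "\<exists>f. \<forall>N. ?P N (f N) \<and> f (Suc N) \<inter> {..<N} = f N"
  proof (rule dependent_nat_choice)
    show "\<exists>A. ?P 0 A" by (rule exI[of _ "{}"]) simp
  next
    fix A N assume A: "?P N A"
    have "{r. S r \<inter> {..<N} = A} \<subseteq> {r. S r \<inter> {..<Suc N} = A} \<union> {r. S r \<inter> {..<Suc N} = insert N A}"
      by (auto simp: lessThan_Suc)
    then have "?P (Suc N) A \<or> ?P (Suc N) (insert N A)"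
      using A by (meson finite_UnI finite_subset)
    moreover have "A \<subseteq> {..<N}" using A by (auto dest: infinite_imp_nonempty)
    then have "A \<inter> {..<N} = A" "insert N A \<inter> {..<N} = A" by auto
    ultimately show "\<exists>B. ?P (Suc N) B \<and> B \<inter> {..<N} = A" by blast
  qed
  then obtain f where f: "\<And>N. ?P N (f N)" "\<And>N. f (Suc N) \<inter> {..<N} = f N" by blast
  have sub: "f N \<subseteq> {..<N}" for N
    using f(2)[of N] by blast
  have coh: "N \<le> M \<Longrightarrow> f M \<inter> {..<N} = f N" for N M
  proof (induction M rule: dec_induct)
    case base
    show ?case using sub[of N] by blast
  next
    case (step M)
    have "f (Suc M) \<inter> {..<N} = f (Suc M) \<inter> {..<M} \<inter> {..<N}" using step.hyps(1) by auto
    also have "\<dots> = f N" unfolding f(2) by (rule step.IH)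
    finally show ?case .
  qed
  define A where "A = (\<Union>N. f N)"
  have Af: "A \<inter> {..<N} = f N" for N
  proof -
    have "f M \<inter> {..<N} \<subseteq> f N" for M
      using coh[of N M] coh[of M N] by (cases "N \<le> M") auto
    then show ?thesis using sub by (auto simp: A_def)
  qed
  have approx: "\<exists>r\<ge>N. S r \<inter> {..<N} = A \<inter> {..<N}" for N
    using f(1)[of N] unfolding infinite_nat_iff_unbounded_le Af by auto
  have no: "\<not> G \<rho>" if \<rho>: "finite \<rho>" "\<rho> \<subseteq> I" "\<rho> \<subseteq> A \<or> \<rho> \<inter> A = {}" for \<rho>
  proof -
    obtain N where N: "\<rho> \<subseteq> {..<N}" using \<rho>(1) finite_nat_iff_bounded by blast
    \<comment> \<open>\<open>S r\<close> excludes only sets below \<open>r\<close> and is known to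
      agree with \<open>A\<close> only below \<open>N\<close>; \<open>N \<le> r\<close> makes both
      apply to \<open>\<rho>\<close>.\<close>
    obtain r where r: "r \<ge> N" "S r \<inter> {..<N} = A \<inter> {..<N}" using approx by blast
    from \<rho>(3) show ?thesis
    proof
      assume "\<rho> \<subseteq> A"
      then have "\<rho> \<subseteq> S r \<inter> {..<r}" using N r by fastforce
      then show ?thesis by (rule S(2))
    next
      assume "\<rho> \<inter> A = {}"
      then have "\<rho> \<subseteq> (I - S r) \<inter> {..<r}" using N r \<rho>(2) by fastforce
      then show ?thesis by (rule S(3))
    qed
  qed
  have "infinite (I \<inter> A) \<or> infinite (I - A)"
    using \<open>infinite I\<close> by (metis finite_Un Int_Diff_Un)
  then show False
  proof
    assume "infinite (I \<inter> A)"
    then obtain \<rho> where "\<rho> \<subseteq> I \<inter> A" "finite \<rho>" "G \<rho>" using good[of "I \<inter> A"] by blast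
    then show False using no[of \<rho>] by blast
  next
    assume "infinite (I - A)"
    then obtain \<rho> where "\<rho> \<subseteq> I - A" "finite \<rho>" "G \<rho>" using good[of "I - A"] by blast
    then show False using no[of \<rho>] by blast
  qed
qed

section \<open>Forcing against a reduction\<close>

text \<open>
  \<open>V k\<close> and \<open>E k\<close> are the vertices and edges of the graph computed from the order \<open>ord k\<close>, and
  \<open>P k X y\<close> says that the backward functional puts \<open>y\<close> into the chain computed from the set \<open>X\<close>,
  which need not be a solution.
\<close>

locale reduction =
  fixes V :: "enum \<Rightarrow> nat set" and E :: "enum \<Rightarrow> nat \<Rightarrow> nat \<Rightarrow> bool"
    and P :: "enum \<Rightarrow> nat set \<Rightarrow> nat \<Rightarrow> bool"
  assumes V_infinite: "bij k \<Longrightarrow> infinite (V k)"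
    and E_sym: "bij k \<Longrightarrow> E k v w \<Longrightarrow> E k w v"
    and E_irrefl: "bij k \<Longrightarrow> \<not> E k v v"
    and E_vertex: "bij k \<Longrightarrow> E k v w \<Longrightarrow> w \<in> V k"
    and graph_use: "bij k \<Longrightarrow> \<exists>u. \<forall>k'. bij k' \<longrightarrow> near u k k' \<longrightarrow>
      (\<forall>v<b. (v \<in> V k' \<longleftrightarrow> v \<in> V k) \<and> (\<forall>w<b. E k' v w \<longleftrightarrow> E k v w))"
    and P_use: "P k X y \<Longrightarrow> \<exists>u. \<forall>k' X'. near u k k' \<longrightarrow> X' \<inter> {..<u} = X \<inter> {..<u} \<longrightarrow> P k' X' y"
    and P_infinite: "bij k \<Longrightarrow> sol (V k) (E k) X \<Longrightarrow> infinite {y. P k X y}"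
    and P_side: "bij k \<Longrightarrow> sol (V k) (E k) X \<Longrightarrow> P k X y \<Longrightarrow> P k X z \<Longrightarrow> low k y \<longleftrightarrow> low k z"
begin

lemma P_fresh:
  assumes "bij k" "sol (V k) (E k) X" "finite F"
  obtains y where "P k X y" "y \<notin> F"
proof -
  have "\<not> {y. P k X y} \<subseteq> F" using P_infinite[OF assms(1,2)] assms(3) finite_subset by blast
  then show ?thesis using that by blast
qed

section \<open>Vertices forced to have finite degree\<close>

definition forced :: "enum \<Rightarrow> nat \<Rightarrow> nat \<Rightarrow> nat \<Rightarrow> bool" where
  "forced k n v b \<longleftrightarrow> (\<forall>k'\<in>nbhd n k. v \<in> V k' \<and> (\<forall>w. E k' v w \<longrightarrow> w < b))"

lemma forced_mono:
  assumes "forced k n v b" "k' \<in> nbhd n k" "n \<le> n'" "b \<le> b'"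
  shows "forced k' n' v b'"
  unfolding forced_def
proof
  fix k'' assume "k'' \<in> nbhd n' k'"
  then have "k'' \<in> nbhd n k" using assms(2,3) nbhd_trans by blast
  then show "v \<in> V k'' \<and> (\<forall>w. E k'' v w \<longrightarrow> w < b')"
    using assms(1,4) unfolding forced_def by (meson less_le_trans)
qed

text \<open>If no condition forces a bound \<open>b\<close> on the neighbours of \<open>v\<close>,
  then some extension either drops \<open>v\<close> from the vertices or gives it a neighbour from
  \<open>b\<close> on. Either event depends on a finite part of the order, so fusion over all pairs
  \<open>(v, b)\<close> applies.\<close>

lemma generic_infinite_degree:
  assumes k: "bij k"
    and none: "\<And>k' n' v b. k' \<in> nbhd n k \<Longrightarrow> n \<le> n' \<Longrightarrow> m \<le> v \<Longrightarrow> \<not> forced k' n' v b"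
  shows "\<exists>k'\<in>nbhd n k. \<forall>v\<ge>m. v \<in> V k' \<longrightarrow> (\<forall>b. \<exists>w\<ge>b. E k' v w)"
proof -
  let ?C = "\<lambda>c k. case prod_decode c of (v, b) \<Rightarrow> m \<le> v \<longrightarrow> v \<in> V k \<longrightarrow> (\<exists>w\<ge>b. E k v w)"
  have "\<exists>k'\<in>nbhd n k. \<forall>c. ?C c k'"
  proof (rule fusion[OF k])
    fix c k1 n1 assume k1: "k1 \<in> nbhd n k" "n \<le> n1"
    obtain v b where c: "prod_decode c = (v, b)" by (cases "prod_decode c")
    show "\<exists>k'\<in>nbhd n1 k1. \<exists>n'\<ge>n1. \<forall>k''\<in>nbhd n' k'. ?C c k''"
    proof (cases "m \<le> v")
      case False
      then show ?thesis using c nbhd_refl[OF nbhd_bij[OF k1(1)]] by auto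
    next
      case True
      then obtain k2 where k2: "k2 \<in> nbhd n1 k1" "v \<in> V k2 \<longrightarrow> (\<exists>w\<ge>b. E k2 v w)"
        using none[OF k1, of v b] unfolding forced_def by (meson not_less)
      then obtain w where w: "v \<in> V k2 \<longrightarrow> w \<ge> b \<and> E k2 v w" by blast
      have bij2: "bij k2" using k2(1) by (rule nbhd_bij)
      obtain u where u: "\<forall>k'. bij k' \<longrightarrow> near u k2 k' \<longrightarrow>
          (\<forall>x<Suc (max v w). (x \<in> V k' \<longleftrightarrow> x \<in> V k2) \<and> (\<forall>y<Suc (max v w). E k' x y \<longleftrightarrow> E k2 x y))"
        using graph_use[OF bij2] by blast
      obtain n' where n': "n' \<ge> n1" "\<forall>k'\<in>nbhd n' k2. near u k2 k'"
        using determine[OF bij2, of n1 u] by blast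
      have "?C c k''" if k'': "k'' \<in> nbhd n' k2" for k''
      proof -
        have "(v \<in> V k'' \<longleftrightarrow> v \<in> V k2) \<and> (E k'' v w \<longleftrightarrow> E k2 v w)"
          using u nbhd_bij[OF k''] n'(2) k'' by (simp add: less_Suc_eq_le)
        then show ?thesis using w c by auto
      qed
      then have "\<forall>k''\<in>nbhd n' k2. ?C c k''" ..
      with n'(1) have "\<exists>n'\<ge>n1. \<forall>k''\<in>nbhd n' k2. ?C c k''" by (intro exI conjI)
      then show ?thesis by (rule bexI[OF _ k2(1)])
    qed
  qed
  then obtain k' where k': "k' \<in> nbhd n k" "\<forall>c. ?C c k'" by blast
  have "\<exists>w\<ge>b. E k' v w" if "m \<le> v" "v \<in> V k'" for v b
    using k'(2)[rule_format, of "prod_encode (v, b)"] that by simp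
  with k'(1) show ?thesis by blast
qed

text \<open>Otherwise the vertices from \<open>m\<close> on generically form a solution. This set is
  computed from the order alone, so a fresh output produced from it depends on a finite part of the
  order and can be put on either side of the cut. Doing so once for each side contradicts
  \<open>P_side\<close>.\<close>

lemma forced_dense:
  assumes k0: "bij k0"
  shows "\<exists>k\<in>nbhd n0 k0. \<exists>n\<ge>n0. \<exists>v\<ge>m. \<exists>b. forced k n v b"
proof (rule ccontr)
  assume "\<not> ?thesis"
  then have none: "\<not> forced k n v b" if "k \<in> nbhd n0 k0" "n0 \<le> n" "m \<le> v" for k n v b
    using that by blast
  let ?W = "\<lambda>k. V k \<inter> {m..}"
  have generic: "\<exists>k'\<in>nbhd n k. sol (V k') (E k') (?W k')" if k: "k \<in> nbhd n0 k0" "n0 \<le> n" for k n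
  proof -
    have "\<not> forced k' n' v b" if "k' \<in> nbhd n k" "n \<le> n'" "m \<le> v" for k' n' v b
      using none nbhd_trans[OF k(1) that(1) k(2)] that(2,3) k(2) le_trans by blast
    then obtain k' where k': "k' \<in> nbhd n k" "\<forall>v\<ge>m. v \<in> V k' \<longrightarrow> (\<forall>b. \<exists>w\<ge>b. E k' v w)"
      using generic_infinite_degree[OF nbhd_bij[OF k(1)], of n m] by blast
    have bij': "bij k'" using k'(1) by (rule nbhd_bij)
    have "infinite {w \<in> ?W k'. E k' v w}" if v: "v \<in> ?W k'" for v
      unfolding infinite_nat_iff_unbounded_le
    proof
      fix c
      have "m \<le> v" "v \<in> V k'" using v by auto
      then obtain w where "w \<ge> max c m" "E k' v w" using k'(2) by blast
      then show "\<exists>w\<ge>c. w \<in> {w \<in> ?W k'. E k' v w}"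
        using E_vertex[OF bij'] by (intro exI[of _ w]) auto
    qed
    moreover have "infinite (?W k')"
      using V_infinite[OF bij'] unfolding infinite_nat_iff_unbounded_le
      by (metis IntI atLeast_iff max.bounded_iff)
    ultimately have "sol (V k') (E k') (?W k')" by (simp add: sol_def)
    with k'(1) show ?thesis by blast
  qed
  have step: "\<exists>k'\<in>nbhd n k. \<exists>n'\<ge>n. \<exists>x. \<forall>k''\<in>nbhd n' k'. P k'' (?W k'') x \<and> (low k'' x \<longleftrightarrow> d)"
    if k: "k \<in> nbhd n0 k0" "n0 \<le> n" for k n d
  proof -
    obtain k1 where k1: "k1 \<in> nbhd n k" "sol (V k1) (E k1) (?W k1)"
      using generic[OF k] by blast
    have bij1: "bij k1" using k1(1) by (rule nbhd_bij)
    obtain x where x: "P k1 (?W k1) x" "x \<notin> k1 ` seg n"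
      using P_fresh[OF bij1 k1(2), of "k1 ` seg n"] by auto
    obtain u where u: "\<forall>k' X'. near u k1 k' \<longrightarrow> X' \<inter> {..<u} = ?W k1 \<inter> {..<u} \<longrightarrow> P k' X' x"
      using P_use[OF x(1)] by blast
    obtain u1 where u1: "\<forall>k'. bij k' \<longrightarrow> near u1 k1 k' \<longrightarrow>
        (\<forall>v<u. (v \<in> V k' \<longleftrightarrow> v \<in> V k1) \<and> (\<forall>w<u. E k' v w \<longleftrightarrow> E k1 v w))"
      using graph_use[OF bij1] by blast
    \<comment> \<open>\<open>u2\<close> covers the use of the output, the part of the graph that
      fixes \<open>?W\<close> below that use, and the output \<open>x\<close> itself.\<close>
    define u2 where "u2 = max (max u u1) (Suc x)"
    obtain k2 where k2: "k2 \<in> nbhd n k1" "near u2 k1 k2"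
      "\<forall>x<u2. x \<notin> k1 ` seg n \<longrightarrow> (low k2 x \<longleftrightarrow> d)"
      using flip[OF bij1] by blast
    obtain n' where n': "n' \<ge> n" "\<forall>k'\<in>nbhd n' k2. near u2 k2 k' \<and> (\<forall>x<u2. low k' x \<longleftrightarrow> low k2 x)"
      using determine[OF nbhd_bij[OF k2(1)]] by blast
    have "P k'' (?W k'') x \<and> (low k'' x \<longleftrightarrow> d)" if k'': "k'' \<in> nbhd n' k2" for k''
    proof
      have near: "near u2 k1 k''" using near_trans[OF k2(2)] n'(2) k'' by blast
      have "near u k1 k''" "near u1 k1 k''"
        using near by (rule near_antimono, simp add: u2_def)+
      moreover from this have "?W k'' \<inter> {..<u} = ?W k1 \<inter> {..<u}"
        using u1 nbhd_bij[OF k''] by blast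
      ultimately show "P k'' (?W k'') x" using u by blast
      have "x < u2" by (simp add: u2_def)
      then show "low k'' x \<longleftrightarrow> d" using n'(2) k'' k2(3) x(2) by blast
    qed
    moreover have "k2 \<in> nbhd n k" using nbhd_trans[OF k1(1) k2(1)] by simp
    ultimately show ?thesis using n'(1) by blast
  qed
  obtain k1 n1 x where k1: "k1 \<in> nbhd n0 k0" "n1 \<ge> n0"
    and x: "\<forall>k''\<in>nbhd n1 k1. P k'' (?W k'') x \<and> (low k'' x \<longleftrightarrow> True)"
    using step[OF nbhd_refl[OF k0] order_refl, of True] by blast
  obtain k2 n2 y where k2: "k2 \<in> nbhd n1 k1" "n2 \<ge> n1"
    and y: "\<forall>k''\<in>nbhd n2 k2. P k'' (?W k'') y \<and> (low k'' y \<longleftrightarrow> False)"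
    using step[OF k1, of False] by blast
  \<comment> \<open>The two outputs persist in all extensions, even where \<open>?W\<close> is no
    solution; only now is the order extended to make \<open>?W\<close> one.\<close>
  have "k2 \<in> nbhd n0 k0" "n0 \<le> n2" using nbhd_trans[OF k1(1) k2(1)] k1(2) k2(2) by auto
  then obtain k3 where k3: "k3 \<in> nbhd n2 k2" "sol (V k3) (E k3) (?W k3)"
    using generic by blast
  moreover have "k3 \<in> nbhd n1 k1" using nbhd_trans[OF k2(1) k3(1) k2(2)] .
  ultimately have "P k3 (?W k3) x" "low k3 x" "P k3 (?W k3) y" "\<not> low k3 y"
    using x y by blast+
  then show False using P_side[OF nbhd_bij[OF k3(1)] k3(2)] by blast
qed

text \<open>Fusion yields an order with infinitely many forced vertices. Ramsey's theorem applies to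
  them, and an infinite clique is excluded by the finite degrees. Different vertices may need
  different conditions.\<close>

lemma forced_independent_set:
  assumes k0: "bij k0"
  obtains k I where "k \<in> nbhd n0 k0" "infinite I" "I \<subseteq> V k" "indep (E k) I"
    "\<And>v. v \<in> I \<Longrightarrow> \<exists>n b. forced k n v b"
proof -
  have "\<exists>k\<in>nbhd n0 k0. \<forall>m. \<exists>v\<ge>m. \<exists>n b. forced k n v b"
  proof (rule fusion[OF k0])
    fix m k n assume k: "k \<in> nbhd n0 k0" "n0 \<le> n"
    obtain k' n' v b where k': "k' \<in> nbhd n k" "n' \<ge> n" "v \<ge> m" "forced k' n' v b"
      using forced_dense[OF nbhd_bij[OF k(1)], of n m] by blast
    have "forced k'' n' v b" if "k'' \<in> nbhd n' k'" for k''
      using forced_mono[OF k'(4) that] by simp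
    with k' show "\<exists>k'\<in>nbhd n k. \<exists>n'\<ge>n. \<forall>k''\<in>nbhd n' k'. \<exists>v\<ge>m. \<exists>n b. forced k'' n v b"
      by blast
  qed
  then obtain k where k: "k \<in> nbhd n0 k0" "\<forall>m. \<exists>v\<ge>m. \<exists>n b. forced k n v b" by blast
  have bij: "bij k" using k(1) by (rule nbhd_bij)
  let ?U = "{v. \<exists>n b. forced k n v b}"
  have "infinite ?U" using k(2) unfolding infinite_nat_iff_unbounded_le by blast
  then obtain I where I: "I \<subseteq> ?U" "infinite I"
    "indep (E k) I \<or> (\<forall>v\<in>I. \<forall>w\<in>I. v \<noteq> w \<longrightarrow> E k v w)"
    using homogeneous_subset[of ?U "E k"] E_sym[OF bij] E_irrefl[OF bij] by metis
  have fin: "v \<in> V k \<and> (\<exists>b. \<forall>w. E k v w \<longrightarrow> w < b)" if "v \<in> I" for v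
    using that I(1) nbhd_refl[OF bij] unfolding forced_def by blast
  have "indep (E k) I"
  proof (rule ccontr)
    assume "\<not> indep (E k) I"
    then have all: "\<forall>v\<in>I. \<forall>w\<in>I. v \<noteq> w \<longrightarrow> E k v w" using I(3) by blast
    obtain v where v: "v \<in> I" using I(2) infinite_imp_nonempty by blast
    then obtain b where b: "\<forall>w. E k v w \<longrightarrow> w < b" using fin by blast
    obtain w where "w \<in> I" "w \<ge> max b (Suc v)"
      using I(2) unfolding infinite_nat_iff_unbounded_le by blast
    then show False using all v b by force
  qed
  with k(1) I fin show ?thesis by (intro that[of k I]) auto
qed

end

text \<open>
  A finite independent set \<open>\<tau>\<^sub>0\<close> of vertices that is decided to have no neighbours beyond \<open>b\<close> and to
  make the backward functional output \<open>x\<close>. Any later output on the other side of the cut is wrong.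
\<close>

locale committed_reduction = reduction +
  fixes k0 :: enum and n0 b x :: nat and \<tau>0 :: "nat set"
  assumes k0: "bij k0"
    and \<tau>0_below: "\<tau>0 \<subseteq> {..<b}"
    and \<tau>0_vertices: "k \<in> nbhd n0 k0 \<Longrightarrow> \<tau>0 \<subseteq> V k"
    and \<tau>0_indep: "k \<in> nbhd n0 k0 \<Longrightarrow> indep (E k) \<tau>0"
    and \<tau>0_nbrs: "k \<in> nbhd n0 k0 \<Longrightarrow> v \<in> \<tau>0 \<Longrightarrow> E k v w \<Longrightarrow> w < b"
    and x_output: "k \<in> nbhd n0 k0 \<Longrightarrow> H \<inter> {..<b} = \<tau>0 \<Longrightarrow> P k H x"
    and x_side: "k \<in> nbhd n0 k0 \<Longrightarrow> low k x \<longleftrightarrow> low k0 x"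
begin

definition wrong :: "enum \<Rightarrow> nat set \<Rightarrow> bool" where
  "wrong k \<rho> \<longleftrightarrow> finite \<rho> \<and> \<rho> \<subseteq> {b..} \<and> (\<exists>y. P k (\<tau>0 \<union> \<rho>) y \<and> low k y \<noteq> low k0 x)"

lemma sol_Un_\<tau>0:
  assumes "k \<in> nbhd n0 k0" "sol (V k) (E k) X" "X \<subseteq> {b..}"
  shows "sol (V k) (E k) (\<tau>0 \<union> X)"
proof (rule sol_Un_isolated[OF assms(2) \<tau>0_vertices[OF assms(1)] \<tau>0_indep[OF assms(1)]])
  show "\<not> E k v w" if "v \<in> \<tau>0" "w \<in> X" for v w
    using \<tau>0_nbrs[OF assms(1) that(1)] that(2) assms(3) by fastforce
qed (rule E_sym[OF nbhd_bij[OF assms(1)]])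

text \<open>A solution \<open>\<rho> \<union> X\<close> with \<open>X\<close> beyond the use of the
  wrong output would, together with \<open>\<tau>0\<close>, yield both that output and
  \<open>x\<close>, on different sides of the cut.\<close>

lemma wrong_not_extendible:
  assumes k: "k \<in> nbhd n0 k0" and \<rho>: "wrong k \<rho>"
  shows "\<exists>u. \<forall>X. sol (V k) (E k) (\<rho> \<union> X) \<longrightarrow> X \<subseteq> {u..} \<longrightarrow> False"
proof -
  obtain y where y: "P k (\<tau>0 \<union> \<rho>) y" "low k y \<noteq> low k0 x" and b: "\<rho> \<subseteq> {b..}"
    using \<rho> unfolding wrong_def by blast
  obtain u where u: "\<forall>k' X'. near u k k' \<longrightarrow> X' \<inter> {..<u} = (\<tau>0 \<union> \<rho>) \<inter> {..<u} \<longrightarrow> P k' X' y"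
    using P_use[OF y(1)] by blast
  \<comment> \<open>The bound is \<open>max u b\<close>: staying beyond \<open>u\<close> preserves
    the wrong output, staying beyond \<open>b\<close> preserves \<open>x\<close>.\<close>
  have False if X: "sol (V k) (E k) (\<rho> \<union> X)" "X \<subseteq> {max u b..}" for X
  proof -
    let ?H = "\<tau>0 \<union> (\<rho> \<union> X)"
    have sub: "X \<subseteq> {u..}" "X \<subseteq> {b..}" using X(2) by auto
    have H: "sol (V k) (E k) ?H"
      using sol_Un_\<tau>0[OF k X(1)] b sub(2) by simp
    have "?H \<inter> {..<b} = \<tau>0" using b sub(2) \<tau>0_below by fastforce
    then have "P k ?H x" by (rule x_output[OF k])
    moreover have "?H \<inter> {..<u} = (\<tau>0 \<union> \<rho>) \<inter> {..<u}" using sub(1) by fastforce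
    then have "P k ?H y" using u near_refl by blast
    ultimately have "low k x \<longleftrightarrow> low k y" by (rule P_side[OF nbhd_bij[OF k] H])
    then show False using y(2) x_side[OF k] by simp
  qed
  then show ?thesis by blast
qed

text \<open>The analogue of the blobs in Seetapun's argument.\<close>

definition bad :: "enum \<Rightarrow> nat set set" where
  "bad k = {\<tau>. wrong k \<tau> \<and> \<tau> \<subseteq> V k \<and> indep (E k) \<tau>}"

text \<open>Otherwise the vertices without a neighbour in \<open>\<tau>\<close> contain a solution
  arbitrarily far out. Adding the independent set \<open>\<tau>\<close> to it keeps it a solution,
  against \<open>wrong_not_extendible\<close>.\<close>

lemma bad_dominating:
  assumes k: "k \<in> nbhd n0 k0" and \<tau>: "\<tau> \<in> bad k"
  shows "finite {w \<in> V k. \<forall>v\<in>\<tau>. \<not> E k v w}"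
proof (rule ccontr)
  assume inf: "infinite {w \<in> V k. \<forall>v\<in>\<tau>. \<not> E k v w}"
  have \<tau>': "wrong k \<tau>" "\<tau> \<subseteq> V k" "indep (E k) \<tau>" using \<tau> by (auto simp: bad_def)
  obtain u where u: "\<forall>X. sol (V k) (E k) (\<tau> \<union> X) \<longrightarrow> X \<subseteq> {u..} \<longrightarrow> False"
    using wrong_not_extendible[OF k \<tau>'(1)] by blast
  let ?U = "{w \<in> V k. \<forall>v\<in>\<tau>. \<not> E k v w} - {..<u}"
  have "infinite ?U" using inf by simp
  then obtain X where X: "sol ?U (E k) X"
    using sol_exists[of ?U "E k"] E_sym[OF nbhd_bij[OF k]] E_irrefl[OF nbhd_bij[OF k]] by metis
  then have XU: "X \<subseteq> ?U" unfolding sol_def by blast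
  with X have "sol (V k) (E k) X" unfolding sol_def by blast
  then have "sol (V k) (E k) (\<tau> \<union> X)"
    by (rule sol_Un_isolated[OF _ \<tau>'(2,3)]) (use XU E_sym[OF nbhd_bij[OF k]] in blast)+
  moreover have "X \<subseteq> {u..}" using XU by fastforce
  ultimately show False using u by blast
qed

text \<open>One round of Seetapun's argument, inside an infinite independent set \<open>I\<close>
  beyond \<open>m\<close> and \<open>b\<close>. With \<open>\<tau>0\<close>, every infinite subset
  of \<open>I\<close> is a solution, so a finite part of it gives a fresh output. Compactness leaves
  finitely many such parts to consider, and one flip turns all their outputs wrong.\<close>

lemma bad_dense:
  assumes k: "k \<in> nbhd n0 k0" "n0 \<le> n"
  shows "\<exists>k'\<in>nbhd n k. \<exists>n'\<ge>n. \<forall>k''\<in>nbhd n' k'.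
    (\<exists>\<tau>\<in>bad k''. \<tau> \<subseteq> {m..}) \<and> (\<forall>X. (\<forall>\<tau>\<in>bad k''. \<tau> \<inter> X \<noteq> {}) \<longrightarrow> (\<exists>\<rho>\<subseteq>X. wrong k'' \<rho>))"
proof -
  obtain k1 I0 where k1: "k1 \<in> nbhd n k" and I0: "infinite I0" "I0 \<subseteq> V k1" "indep (E k1) I0"
    using forced_independent_set[OF nbhd_bij[OF k(1)], of n] by metis
  have bij1: "bij k1" using k1 by (rule nbhd_bij)
  have k10: "k1 \<in> nbhd n0 k0" using nbhd_trans[OF k(1) k1 k(2)] .
  define I where "I = I0 - {..<max m b}"
  have I: "infinite I" "I \<subseteq> V k1" "indep (E k1) I" "I \<subseteq> {b..}" "I \<subseteq> {m..}"
    using I0 by (auto simp: I_def indep_def)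
  \<comment> \<open>Only outputs not yet decided count, since their side can still be
    chosen.\<close>
  define good where "good \<rho> \<longleftrightarrow> (\<exists>y. y \<notin> k1 ` seg n \<and> P k1 (\<tau>0 \<union> \<rho>) y)" for \<rho>
  have ex_good: "\<exists>\<rho>\<subseteq>R. finite \<rho> \<and> good \<rho>" if R: "R \<subseteq> I" "infinite R" for R
  proof -
    have "R \<subseteq> V k1" "R \<subseteq> {b..}" using R(1) I(2,4) by auto
    moreover have "indep (E k1) R" using R(1) I(3) unfolding indep_def by blast
    ultimately have "sol (V k1) (E k1) (\<tau>0 \<union> R)"
      by (intro sol_Un_\<tau>0[OF k10] sol_indep R(2))
    then obtain y where y: "P k1 (\<tau>0 \<union> R) y" "y \<notin> k1 ` seg n"
      using P_fresh[OF bij1, of _ "k1 ` seg n"] by auto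
    obtain u where "\<forall>k' X'. near u k1 k' \<longrightarrow> X' \<inter> {..<u} = (\<tau>0 \<union> R) \<inter> {..<u} \<longrightarrow> P k' X' y"
      using P_use[OF y(1)] by blast
    moreover have "(\<tau>0 \<union> (R \<inter> {..<u})) \<inter> {..<u} = (\<tau>0 \<union> R) \<inter> {..<u}" by blast
    ultimately have "P k1 (\<tau>0 \<union> (R \<inter> {..<u})) y" using near_refl by blast
    then show ?thesis using y(2) unfolding good_def by (intro exI[of _ "R \<inter> {..<u}"]) auto
  qed
  obtain N where N: "\<And>S. S \<subseteq> I \<Longrightarrow>
      (\<exists>\<rho>\<subseteq>S \<inter> {..<N}. good \<rho>) \<or> (\<exists>\<rho>\<subseteq>(I - S) \<inter> {..<N}. good \<rho>)"
    using two_colouring_compactness[OF ex_good I(1)] by blast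
  define F where "F = {\<rho>. \<rho> \<subseteq> I \<inter> {..<N} \<and> good \<rho>}"
  let ?Q = "\<lambda>\<rho> u. \<exists>y<u. y \<notin> k1 ` seg n \<and> (\<forall>k'. near u k1 k' \<longrightarrow> P k' (\<tau>0 \<union> \<rho>) y)"
  have "\<exists>u. \<forall>\<rho>\<in>F. ?Q \<rho> u"
  proof (rule finite_uniform_bound)
    have "F \<subseteq> Pow {..<N}" by (auto simp: F_def)
    then show "finite F" by (rule finite_subset) simp
  next
    fix \<rho> assume "\<rho> \<in> F"
    then obtain y where y: "y \<notin> k1 ` seg n" "P k1 (\<tau>0 \<union> \<rho>) y" by (auto simp: F_def good_def)
    obtain u where u: "\<forall>k' X'. near u k1 k' \<longrightarrow> X' \<inter> {..<u} = (\<tau>0 \<union> \<rho>) \<inter> {..<u} \<longrightarrow> P k' X' y"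
      using P_use[OF y(2)] by blast
    have "?Q \<rho> (max u (Suc y))"
    proof (intro exI conjI allI impI)
      fix k' assume "near (max u (Suc y)) k1 k'"
      then have "near u k1 k'" by (rule near_antimono) simp
      then show "P k' (\<tau>0 \<union> \<rho>) y" using u by blast
    qed (use y(1) in auto)
    then show "\<exists>u. ?Q \<rho> u" ..
  next
    fix \<rho> u v assume "?Q \<rho> u" "u \<le> v"
    then show "?Q \<rho> v" by (meson less_le_trans near_antimono)
  qed
  then obtain u where u: "\<And>\<rho>. \<rho> \<in> F \<Longrightarrow> ?Q \<rho> u" by blast
  obtain u1 where u1: "\<forall>k'. bij k' \<longrightarrow> near u1 k1 k' \<longrightarrow>
      (\<forall>v<N. (v \<in> V k' \<longleftrightarrow> v \<in> V k1) \<and> (\<forall>w<N. E k' v w \<longleftrightarrow> E k1 v w))"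
    using graph_use[OF bij1] by blast
  \<comment> \<open>Below \<open>u\<close> lie the uses and outputs of all sets in \<open>F\<close>;
    agreement below \<open>u1\<close> keeps these sets independent sets of vertices after the
    flip.\<close>
  define u2 where "u2 = max u u1"
  obtain k2 where k2: "k2 \<in> nbhd n k1" "near u2 k1 k2"
    "\<forall>y<u2. y \<notin> k1 ` seg n \<longrightarrow> (low k2 y \<longleftrightarrow> \<not> low k0 x)"
    using flip[OF bij1] by blast
  obtain n' where n': "n' \<ge> n" "\<forall>k'\<in>nbhd n' k2. near u2 k2 k' \<and> (\<forall>y<u2. low k' y \<longleftrightarrow> low k2 y)"
    using determine[OF nbhd_bij[OF k2(1)]] by blast
  have "(\<exists>\<tau>\<in>bad k''. \<tau> \<subseteq> {m..}) \<and> (\<forall>X. (\<forall>\<tau>\<in>bad k''. \<tau> \<inter> X \<noteq> {}) \<longrightarrow> (\<exists>\<rho>\<subseteq>X. wrong k'' \<rho>))"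
    if k'': "k'' \<in> nbhd n' k2" for k''
  proof -
    have "near u2 k1 k''" using near_trans[OF k2(2)] n'(2) k'' by blast
    then have near: "near u k1 k''" "near u1 k1 k''"
      by (rule near_antimono, simp add: u2_def)+
    have F_bad: "\<rho> \<in> bad k''" if \<rho>: "\<rho> \<in> F" for \<rho>
    proof -
      have sub: "\<rho> \<subseteq> I" "\<rho> \<subseteq> {..<N}" using \<rho> by (auto simp: F_def)
      obtain y where y: "y < u" "y \<notin> k1 ` seg n" "P k'' (\<tau>0 \<union> \<rho>) y"
        using u[OF \<rho>] near(1) by blast
      have "y < u2" using y(1) by (simp add: u2_def)
      then have "low k'' y \<longleftrightarrow> \<not> low k0 x" using n'(2) k'' k2(3) y(2) by blast
      then have wrong: "wrong k'' \<rho>"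
        unfolding wrong_def using y(3) sub I(4) finite_subset[OF sub(2)] by blast
      note same = u1[rule_format, OF nbhd_bij[OF k''] near(2)]
      have "\<rho> \<subseteq> V k''" using same sub I(2) by blast
      moreover have "\<not> E k'' v w" if vw: "v \<in> \<rho>" "w \<in> \<rho>" for v w
      proof -
        have "v < N" "w < N" "v \<in> I" "w \<in> I" using sub vw by auto
        then show ?thesis using same I(3) unfolding indep_def by blast
      qed
      ultimately show ?thesis using wrong unfolding bad_def indep_def by blast
    qed
    show ?thesis
    proof (intro conjI allI impI)
      obtain \<rho> where \<rho>: "\<rho> \<subseteq> I \<inter> {..<N}" "good \<rho>" using N[of I] by auto
      then have "\<rho> \<in> bad k''" by (intro F_bad) (simp add: F_def)
      moreover have "\<rho> \<subseteq> {m..}" using \<rho>(1) I(5) by blast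
      ultimately show "\<exists>\<tau>\<in>bad k''. \<tau> \<subseteq> {m..}" ..
    next
      fix X assume X: "\<forall>\<tau>\<in>bad k''. \<tau> \<inter> X \<noteq> {}"
      \<comment> \<open>A good set in the part of \<open>I\<close> outside \<open>X\<close> would be
        a bad set that misses \<open>X\<close>; so compactness puts a good set inside
        \<open>X\<close>.\<close>
      have "\<not> (\<exists>\<rho>\<subseteq>(I - I \<inter> X) \<inter> {..<N}. good \<rho>)"
      proof
        assume "\<exists>\<rho>\<subseteq>(I - I \<inter> X) \<inter> {..<N}. good \<rho>"
        then obtain \<rho> where \<rho>: "\<rho> \<subseteq> (I - I \<inter> X) \<inter> {..<N}" "good \<rho>" by blast
        then have "\<rho> \<in> bad k''" by (intro F_bad) (auto simp: F_def)
        then show False using X \<rho>(1) by blast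
      qed
      then obtain \<rho> where \<rho>: "\<rho> \<subseteq> I \<inter> X \<inter> {..<N}" "good \<rho>"
        using N[of "I \<inter> X"] by blast
      then have "\<rho> \<in> bad k''" by (intro F_bad) (auto simp: F_def)
      then show "\<exists>\<rho>\<subseteq>X. wrong k'' \<rho>" using \<rho>(1) unfolding bad_def by blast
    qed
  qed
  moreover have "k2 \<in> nbhd n k" using nbhd_trans[OF k1 k2(1)] by simp
  ultimately show ?thesis using n'(1) by blast
qed

text \<open>The wrong set \<open>\<rho>\<close> found inside \<open>Y\<close> is not known to be
  independent, so it need not be in \<open>bad k\<close>. It extends to a solution because all
  degrees in \<open>Y\<close> are infinite and stay so when an initial part of \<open>Y\<close>
  outside \<open>\<rho>\<close> is dropped.\<close>

lemma no_committed_reduction: False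
proof -
  have "\<exists>k\<in>nbhd n0 k0. \<forall>m. (\<exists>\<tau>\<in>bad k. \<tau> \<subseteq> {m..}) \<and>
      (\<forall>X. (\<forall>\<tau>\<in>bad k. \<tau> \<inter> X \<noteq> {}) \<longrightarrow> (\<exists>\<rho>\<subseteq>X. wrong k \<rho>))"
    by (rule fusion[OF k0]) (rule bad_dense)
  then obtain k where k: "k \<in> nbhd n0 k0" and far: "\<exists>\<tau>\<in>bad k. \<tau> \<subseteq> {m..}"
    and trans: "(\<forall>\<tau>\<in>bad k. \<tau> \<inter> X \<noteq> {}) \<Longrightarrow> \<exists>\<rho>\<subseteq>X. wrong k \<rho>" for m X
    by meson
  have bad: "finite \<tau>" "\<tau> \<subseteq> V k" "\<tau> \<subseteq> {b..}" if "\<tau> \<in> bad k" for \<tau>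
    using that by (auto simp: bad_def wrong_def)
  have dom: "finite {w \<in> \<Union>(bad k). \<forall>v\<in>\<tau>. \<not> E k v w}" if \<tau>: "\<tau> \<in> bad k" for \<tau>
    by (rule finite_subset[OF _ bad_dominating[OF k \<tau>]]) (use bad(2) in blast)
  \<comment> \<open>The empty set dominates nothing, while \<open>V k\<close> is infinite.\<close>
  have ne: "\<tau> \<noteq> {}" if \<tau>: "\<tau> \<in> bad k" for \<tau>
    using bad_dominating[OF k \<tau>] V_infinite[OF nbhd_bij[OF k]] by auto
  obtain Y where Y: "Y \<subseteq> \<Union>(bad k)" "infinite Y" "\<And>v. v \<in> Y \<Longrightarrow> infinite {w \<in> Y. E k v w}"
    "\<And>\<tau>. \<tau> \<in> bad k \<Longrightarrow> \<tau> \<inter> Y \<noteq> {}"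
    using perfect_subset_of_dominating_family[of "bad k" "E k", OF bad(1) dom far ne] by blast
  obtain \<rho> where \<rho>: "\<rho> \<subseteq> Y" "wrong k \<rho>" using trans[of Y] Y(4) by blast
  obtain u where u: "\<forall>X. sol (V k) (E k) (\<rho> \<union> X) \<longrightarrow> X \<subseteq> {u..} \<longrightarrow> False"
    using wrong_not_extendible[OF k \<rho>(2)] by blast
  let ?X = "Y - {..<u}"
  have "infinite {w \<in> \<rho> \<union> ?X. E k v w}" if "v \<in> Y" for v
  proof -
    have "infinite ({w \<in> Y. E k v w} - {..<u})" using Y(3)[OF that] by simp
    moreover have "{w \<in> Y. E k v w} - {..<u} \<subseteq> {w \<in> \<rho> \<union> ?X. E k v w}" by blast
    ultimately show ?thesis using finite_subset by blast
  qed
  moreover have "\<rho> \<union> ?X \<subseteq> Y" using \<rho>(1) by blast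
  moreover have "Y \<subseteq> V k" using Y(1) bad(2) by blast
  moreover have "infinite (\<rho> \<union> ?X)" using Y(2) by simp
  ultimately have "sol (V k) (E k) (\<rho> \<union> ?X)" unfolding sol_def by blast
  moreover have "?X \<subseteq> {u..}" by auto
  ultimately show False using u by blast
qed

end

section \<open>Reaching a committed condition\<close>

context reduction
begin

lemma no_reduction: False
proof -
  \<comment> \<open>Any bijection serves as a start: \<open>seg 0\<close> is empty, so the condition
    is trivial.\<close>
  have "bij (sum_encode :: enum)" by (rule bij_sum_encode)
  then obtain k I where I: "infinite I" "I \<subseteq> V k" "indep (E k) I"
    and forced: "\<And>v. v \<in> I \<Longrightarrow> \<exists>n b. forced k n v b" and k: "bij k"
    using forced_independent_set[of sum_encode 0] nbhd_bij by metis
  have "sol (V k) (E k) I" using I by (intro sol_indep)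
  then obtain x where x: "P k I x" using P_fresh[OF k, of I "{}"] by blast
  obtain u where u: "\<forall>k' X'. near u k k' \<longrightarrow> X' \<inter> {..<u} = I \<inter> {..<u} \<longrightarrow> P k' X' x"
    using P_use[OF x] by blast
  obtain u1 where u1: "\<forall>k'. bij k' \<longrightarrow> near u1 k k' \<longrightarrow>
      (\<forall>v<u. (v \<in> V k' \<longleftrightarrow> v \<in> V k) \<and> (\<forall>w<u. E k' v w \<longleftrightarrow> E k v w))"
    using graph_use[OF k] by blast
  define \<tau>0 where "\<tau>0 = I \<inter> {..<u}"
  \<comment> \<open>Since \<open>\<tau>0\<close> is finite, one \<open>c\<close> can serve both as
    the level of the condition and as the bound on neighbours.\<close>
  have "\<exists>c. \<forall>v\<in>\<tau>0. forced k c v c"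
  proof (rule finite_uniform_bound)
    fix v assume "v \<in> \<tau>0"
    then have "v \<in> I" by (simp add: \<tau>0_def)
    then obtain n b where nb: "forced k n v b" using forced by blast
    have "forced k (max n b) v (max n b)"
      by (rule forced_mono[OF nb nbhd_refl[OF k]]) auto
    then show "\<exists>c. forced k c v c" ..
  next
    fix v c c' assume "forced k c v c" "c \<le> c'"
    then show "forced k c' v c'" using forced_mono nbhd_refl[OF k] by blast
  qed (simp add: \<tau>0_def)
  then obtain c where c: "\<And>v. v \<in> \<tau>0 \<Longrightarrow> forced k c v c" by blast
  define u2 where "u2 = max (max u u1) (Suc x)"
  obtain n0 where n0: "n0 \<ge> c" "\<forall>k'\<in>nbhd n0 k. near u2 k k' \<and> (\<forall>x<u2. low k' x \<longleftrightarrow> low k x)"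
    using determine[OF k] by blast
  \<comment> \<open>\<open>c\<close> bounds the neighbours of \<open>\<tau>0\<close>. Including
    \<open>u\<close> ensures that a set with initial part \<open>\<tau>0\<close> below
    \<open>b\<close> looks like \<open>I\<close> up to the use of \<open>x\<close>.\<close>
  define b where "b = max c u"
  have near: "near u k k'" "near u1 k k'" if "k' \<in> nbhd n0 k" for k'
    using n0(2) that by (auto simp: u2_def intro: near_antimono)
  have nbrs: "v \<in> V k' \<and> (\<forall>w. E k' v w \<longrightarrow> w < c)" if "k' \<in> nbhd n0 k" "v \<in> \<tau>0" for k' v
    using c[OF that(2)] nbhd_antimono[OF that(1) n0(1)] unfolding forced_def by blast
  interpret committed_reduction V E P k n0 b x \<tau>0
  proof
    show "bij k" by (rule k)
    show "\<tau>0 \<subseteq> {..<b}" by (auto simp: \<tau>0_def b_def)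
    fix k' assume k': "k' \<in> nbhd n0 k"
    show "\<tau>0 \<subseteq> V k'" using nbrs[OF k'] by blast
    show "indep (E k') \<tau>0"
      using u1 near(2)[OF k'] nbhd_bij[OF k'] I(3) by (auto simp: indep_def \<tau>0_def)
    show "w < b" if "v \<in> \<tau>0" "E k' v w" for v w
      using nbrs[OF k' that(1)] that(2) by (auto simp: b_def less_max_iff_disj)
    show "P k' H x" if "H \<inter> {..<b} = \<tau>0" for H
    proof -
      have "H \<inter> {..<u} = H \<inter> {..<b} \<inter> {..<u}" by (auto simp: b_def)
      then have "H \<inter> {..<u} = I \<inter> {..<u}" using that by (auto simp: \<tau>0_def)
      then show ?thesis using u near(1)[OF k'] by blast
    qed
    have "x < u2" by (simp add: u2_def)
    then show "low k' x \<longleftrightarrow> low k x" using n0(2) k' by blast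
  qed
  show False by (rule no_committed_reduction)
qed

end

section \<open>Turing functionals on codes of orders\<close>

lemma SADC_input_ord:
  assumes k: "bij k"
  shows "SADC_input UNIV (ord k)"
proof -
  have ord: "(x, y) \<in> ord k \<longleftrightarrow> less_omega_omega_star (inv k x) (inv k y)" for x y
    using ord_iff[OF k, of "inv k x" "inv k y"] k by (simp add: bij_is_surj surj_f_inv_f)
  have inj: "inv k x = inv k y \<Longrightarrow> x = y" for x y
    using k by (metis bij_is_surj surj_f_inv_f)
  have tr: "less_omega_omega_star u v \<Longrightarrow> less_omega_omega_star v w \<Longrightarrow> less_omega_omega_star u w" for u v w
    by (cases u; cases v; cases w) auto
  have irr: "\<not> less_omega_omega_star u u" for u
    by (cases u) auto
  have tot: "less_omega_omega_star u v \<or> u = v \<or> less_omega_omega_star v u" for u v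
    by (cases u; cases v) auto
  have "strict_linear_order_on UNIV (ord k)"
    unfolding strict_linear_order_on_def
  proof (intro conjI)
    show "trans (ord k)" by (rule transI) (use tr in \<open>auto simp: ord\<close>)
    show "irrefl (ord k)" by (simp add: irrefl_def ord irr)
    show "total (ord k)" unfolding total_on_def ord using tot inj by blast
  qed
  moreover have "order_type_omega_omega_star UNIV (ord k)"
    unfolding order_type_omega_omega_star_def
    by (rule exI[of _ "inv k"]) (simp add: ord bij_imp_bij_inv[OF k])
  ultimately show ?thesis by (simp add: SADC_input_def)
qed

text \<open>All but finitely many numbers lie below a given element of the upper part and above a
  given element of the lower part. An infinite set meeting both parts is therefore neither ascending
  nor descending.\<close>

lemma chain_side:
  assumes k: "bij k" and C: "infinite C" "ascending_chain (ord k) C \<or> descending_chain (ord k) C"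
    and xy: "x \<in> C" "y \<in> C" "low k x"
  shows "low k y"
proof (rule ccontr)
  assume "\<not> low k y"
  obtain u v where uv: "x = k u" "y = k v" using k by (metis bij_pointE)
  obtain i where i: "x = k (Inl i)" using \<open>low k x\<close> by (auto simp: low_def)
  obtain j where j: "y = k (Inr j)"
    using \<open>\<not> low k y\<close> low_simps(1)[OF k] uv by (cases v) auto
  have img: "\<exists>w. z = k w" for z using k by (metis bij_pointE)
  have "C \<subseteq> {z \<in> C. (z, y) \<in> ord k} \<union> (k ` Inr ` {..j})"
  proof
    fix z assume z: "z \<in> C"
    obtain w where "z = k w" using img by blast
    then show "z \<in> {z \<in> C. (z, y) \<in> ord k} \<union> (k ` Inr ` {..j})"
      using z j ord_iff[OF k, of w "Inr j"] by (cases w) auto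
  qed
  then have 1: "infinite {z \<in> C. (z, y) \<in> ord k}"
    using C(1) finite_subset by fastforce
  have "C \<subseteq> {z \<in> C. (x, z) \<in> ord k} \<union> (k ` Inl ` {..i})"
  proof
    fix z assume z: "z \<in> C"
    obtain w where "z = k w" using img by blast
    then show "z \<in> {z \<in> C. (x, z) \<in> ord k} \<union> (k ` Inl ` {..i})"
      using z i ord_iff[OF k, of "Inl i" w] by (cases w) auto
  qed
  then have 2: "infinite {z \<in> C. (x, z) \<in> ord k}"
    using C(1) finite_subset by fastforce
  from C(2) 1 2 xy(1,2) show False
    unfolding ascending_chain_def descending_chain_def by blast
qed

text \<open>\<open>prod_encode (x, y)\<close> is at least \<open>x\<close> and \<open>y\<close>, so
  a bit of the code below \<open>u\<close> concerns only numbers below \<open>u\<close>.\<close>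

lemma order_code_near:
  assumes "near u k k'" "i < u"
  shows "order_code UNIV (ord k') i = order_code UNIV (ord k) i"
proof -
  obtain x y where xy: "i div 2 = prod_encode (x, y)" by (metis prod_decode_inverse surj_pair)
  have "x < u" "y < u"
    using xy le_prod_encode_1[of x y] le_prod_encode_2[of y x] assms(2) by linarith+
  then have "(x, y) \<in> ord k' \<longleftrightarrow> (x, y) \<in> ord k"
    using assms(1) by (simp add: near_def)
  moreover have "prod_encode (x, y) \<in> prod_encode ` R \<longleftrightarrow> (x, y) \<in> R" for R
    by (rule inj_image_mem_iff[OF inj_prod_encode])
  ultimately show ?thesis
    by (simp add: order_code_def join_def xy indicator_def)
qed

lemma join_near:
  assumes "near u k k'" "X' \<inter> {..<u} = X \<inter> {..<u}" "i < u"
  shows "join (order_code UNIV (ord k')) (indicator X') i = join (order_code UNIV (ord k)) (indicator X) i"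
proof -
  have "i div 2 < u" using assms(3) by simp
  then have "i div 2 \<in> X' \<longleftrightarrow> i div 2 \<in> X" using assms(2) by blast
  then show ?thesis
    using order_code_near[OF assms(1) \<open>i div 2 < u\<close>] by (simp add: join_def indicator_def)
qed

theorem theorem6p7:
  shows "\<not> SADC \<le>\<^sub>W wRSgr"
proof
  assume "SADC \<le>\<^sub>W wRSgr"
  then obtain \<Phi> \<Psi> where \<Phi>: "turing_functional \<Phi>" and \<Psi>: "turing_functional \<Psi>"
    and red: "\<forall>f\<in>pdom SADC. \<exists>h. \<Phi> f = Some h \<and> h \<in> pdom wRSgr \<and>
        (\<forall>g\<in>wRSgr h. \<exists>c. \<Psi> (join f g) = Some c \<and> c \<in> SADC f)"
    unfolding weihrauch_le_def by blast
  obtain p where p: "\<And>f h. \<Phi> f = Some h \<longleftrightarrow> (\<forall>n. evals f p [n] (h n))"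
    using \<Phi> unfolding turing_functional_def by blast
  obtain q where q: "\<And>f h. \<Psi> f = Some h \<longleftrightarrow> (\<forall>n. evals f q [n] (h n))"
    using \<Psi> unfolding turing_functional_def by blast
  define code where "code k = order_code UNIV (ord k)" for k
  \<comment> \<open>Asking only for the value 1 makes \<open>P\<close> meaningful for every
    \<open>X\<close>, including sets on which the backward functional is not total.\<close>
  define P where "P k X y \<longleftrightarrow> evals (join (code k) (indicator X)) q [y] 1" for k X y
  have "\<forall>k. \<exists>V E. bij k \<longrightarrow> wRSgr_input V E \<and> \<Phi> (code k) = Some (graph_code V E) \<and>
      (\<forall>g\<in>wRSgr (graph_code V E). \<exists>c. \<Psi> (join (code k) g) = Some c \<and> c \<in> SADC (code k))"
  proof (intro allI)
    fix k
    show "\<exists>V E. bij k \<longrightarrow> wRSgr_input V E \<and> \<Phi> (code k) = Some (graph_code V E) \<and>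
      (\<forall>g\<in>wRSgr (graph_code V E). \<exists>c. \<Psi> (join (code k) g) = Some c \<and> c \<in> SADC (code k))"
    proof (cases "bij k")
      case True
      then have "code k \<in> pdom SADC"
        using SADC_input_ord unfolding pdom_SADC code_def by blast
      with red obtain h where h: "\<Phi> (code k) = Some h" "h \<in> pdom wRSgr"
        "\<forall>g\<in>wRSgr h. \<exists>c. \<Psi> (join (code k) g) = Some c \<and> c \<in> SADC (code k)" by blast
      then obtain V E where "h = graph_code V E" "wRSgr_input V E"
        unfolding pdom_wRSgr by blast
      with h show ?thesis by blast
    qed simp
  qed
  then obtain V E where input: "\<And>k. bij k \<Longrightarrow> wRSgr_input (V k) (E k)"
    and fwd: "\<And>k. bij k \<Longrightarrow> \<Phi> (code k) = Some (graph_code (V k) (E k))"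
    and bwd: "\<And>k g. bij k \<Longrightarrow> g \<in> wRSgr (graph_code (V k) (E k)) \<Longrightarrow>
      \<exists>c. \<Psi> (join (code k) g) = Some c \<and> c \<in> SADC (code k)"
    by metis
  define A where "A k v w \<longleftrightarrow> {v, w} \<in> E k" for k v w
  have edges: "E k \<subseteq> [V k]\<^bsup>2\<^esup>" if "bij k" for k
    using input[OF that] by (simp add: wRSgr_input_def)
  \<comment> \<open>The order \<open>k'\<close> is again an instance, so its graph code is total;
    the shared computation and determinism then make the two bits equal.\<close>
  have bit_use: "\<exists>u. \<forall>k'. bij k' \<longrightarrow> near u k k' \<longrightarrow>
      graph_code (V k') (E k') i = graph_code (V k) (E k) i" if k: "bij k" for k i
  proof -
    have "evals (code k) p [i] (graph_code (V k) (E k) i)" using fwd[OF k] p by blast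
    then obtain u where u: "\<forall>g. (\<forall>j<u. g j = code k j) \<longrightarrow> evals g p [i] (graph_code (V k) (E k) i)"
      using evals_use by blast
    have "graph_code (V k') (E k') i = graph_code (V k) (E k) i" if k': "bij k'" "near u k k'" for k'
    proof -
      have "\<forall>j<u. code k' j = code k j" using order_code_near[OF k'(2)] by (simp add: code_def)
      then have "evals (code k') p [i] (graph_code (V k) (E k) i)" using u by blast
      moreover have "evals (code k') p [i] (graph_code (V k') (E k') i)" using fwd[OF k'(1)] p by blast
      ultimately show ?thesis by (rule evals_deterministic[THEN sym])
    qed
    then show ?thesis by blast
  qed
  have vertex: "v \<in> V k \<longleftrightarrow> graph_code (V k) (E k) (2 * v) = 1" for k v
    by (simp add: graph_code_def join_def indicator_def)
  have edge: "A k v w \<longleftrightarrow> graph_code (V k) (E k) (2 * prod_encode (v, w) + 1) = 1" for k v w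
    by (simp add: graph_code_def join_def indicator_def A_def)
  have solution: "\<exists>C. (\<forall>y. P k X y \<longleftrightarrow> y \<in> C) \<and> infinite C \<and>
      (ascending_chain (ord k) C \<or> descending_chain (ord k) C)"
    if k: "bij k" and X: "sol (V k) (A k) X" for k X
  proof -
    have nbrs: "X \<inter> neighbours (E k) v = {w \<in> X. A k v w}" for v
      by (auto simp: neighbours_def A_def)
    have "X \<subseteq> V k \<and> infinite X \<and>
      (\<forall>v\<in>X. infinite (X \<inter> neighbours (E k) v) \<or> X \<inter> neighbours (E k) v = {})"
      using X unfolding sol_def nbrs .
    then have "indicator X \<in> wRSgr (graph_code (V k) (E k))"
      unfolding wRSgr_def using input[OF k] by blast
    from bwd[OF k this] obtain c where c: "\<Psi> (join (code k) (indicator X)) = Some c" "c \<in> SADC (code k)"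
      by blast
    then obtain L R C where C: "c = indicator C" "code k = order_code L R" "infinite C"
      "ascending_chain R C \<or> descending_chain R C"
      unfolding SADC_def by blast
    have R: "R = ord k" using C(2) unfolding code_def order_code_inject by simp
    have ev: "evals (join (code k) (indicator X)) q [y] (c y)" for y using c(1) q by blast
    have "P k X y \<longleftrightarrow> y \<in> C" for y
    proof
      assume "P k X y"
      then have "c y = 1" using ev evals_deterministic unfolding P_def by blast
      then show "y \<in> C" by (cases "y \<in> C") (simp_all add: C(1))
    next
      assume "y \<in> C"
      then show "P k X y" using ev[of y] by (simp add: P_def C(1))
    qed
    then show ?thesis using C(3,4) R by blast
  qed
  interpret reduction V A P
  proof
    fix k :: enum and b v w :: nat assume k: "bij k"
    show "infinite (V k)" using input[OF k] by (simp add: wRSgr_input_def)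
    show "A k w v" if "A k v w" using that by (simp add: A_def insert_commute)
    show "\<not> A k v v" using edges[OF k] by (auto simp: A_def nsets_def)
    show "w \<in> V k" if "A k v w" using that edges[OF k] by (auto simp: A_def nsets_def)
    let ?Q = "\<lambda>i u. \<forall>k'. bij k' \<longrightarrow> near u k k' \<longrightarrow>
      graph_code (V k') (E k') i = graph_code (V k) (E k) i"
    \<comment> \<open>The positions in the graph code that record the vertices and edges below
      \<open>b\<close>.\<close>
    let ?I = "(\<lambda>v. 2 * v) ` {..<b} \<union> (\<lambda>(v, w). 2 * prod_encode (v, w) + 1) ` ({..<b} \<times> {..<b})"
    have "\<exists>u. \<forall>i\<in>?I. ?Q i u"
    proof (rule finite_uniform_bound)
      show "finite ?I" by simp
      show "\<exists>u. ?Q i u" for i by (rule bit_use[OF k])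
      show "?Q i u'" if "?Q i u" "u \<le> u'" for i u u' using that near_antimono by blast
    qed
    then obtain u where u: "\<forall>i\<in>?I. ?Q i u" ..
    show "\<exists>u. \<forall>k'. bij k' \<longrightarrow> near u k k' \<longrightarrow>
      (\<forall>v<b. (v \<in> V k' \<longleftrightarrow> v \<in> V k) \<and> (\<forall>w<b. A k' v w \<longleftrightarrow> A k v w))"
      unfolding vertex edge by (rule exI[of _ u]) (use u in auto)
  next
    fix k X y assume "P k X y"
    then obtain u where u: "\<forall>g. (\<forall>i<u. g i = join (code k) (indicator X) i) \<longrightarrow> evals g q [y] 1"
      unfolding P_def using evals_use by blast
    have "P k' X' y" if "near u k k'" "X' \<inter> {..<u} = X \<inter> {..<u}" for k' X'
      unfolding P_def by (rule u[rule_format]) (use join_near[OF that] in \<open>simp add: code_def\<close>)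
    then show "\<exists>u. \<forall>k' X'. near u k k' \<longrightarrow> X' \<inter> {..<u} = X \<inter> {..<u} \<longrightarrow> P k' X' y" by blast
  next
    fix k :: enum and X assume k: "bij k" and X: "sol (V k) (A k) X"
    from solution[OF k X] obtain C where C: "\<And>y. P k X y \<longleftrightarrow> y \<in> C" "infinite C"
      "ascending_chain (ord k) C \<or> descending_chain (ord k) C" by blast
    show "infinite {y. P k X y}" using C(1,2) by simp
    show "low k y \<longleftrightarrow> low k z" if "P k X y" "P k X z" for y z
      using chain_side[OF k C(2,3)] that unfolding C(1) by blast
  qed
  show False by (rule no_reduction)
qed

end
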